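(* Consider the isotropic TV regularized problem $$\min_{u\in X}\ D(u)+\alpha\|\nabla u\|_1,\qquad D(u)=\tfrac12\|Ku-z\|_2^2+\tfrac{\mu}{2}\|\nabla u\|_2^2,\tag{P}$$ and let $(u^k,p^k,\lambda^k)$ be the sequence generated by the semismooth Newton based augmented Lagrangian method described in the context (ALM-PDP, ALM-PDD or ALM-PT), with the inner stopping criterion (A). Then $(u^k,p^k,\lambda^k)$ is bounded and converges globally (for every initial multiplier) to some $(u^*,p^*,\lambda^* )$, where $u^*$ solves (P), $p^*=\nabla u^*$, and $\lambda^*$ solves the dual problem. If $\lambda^*$ satisfies the strict complementarity assumption (SC) of the context, so that $T_d:=\partial d$ is metrically subregular at $\lambda^*$ for the origin, with modulus $\kappa_d$, and if the additional stopping criterion (B1) is used, then $\{\lambda^k\}$ converges to $\lambda^*\in\mathcal{X}^I$ and for all sufficiently large $k$ $$\mathrm{dist}(\lambda^{k+1},\mathcal{X}^I)\le\theta_k\,\mathrm{dist}(\lambda^k,\mathcal{X}^I),$$ where $\theta_k=[\kappa_d(\kappa_d^2+\sigma_k^2)^{-1/2}+\delta_k](1-\delta_k)^{-1}$ and $\theta_k\to\theta_\infty=\kappa_d(\kappa_d^2+\sigma_\infty^2)^{-1/2}<1$ as $k\to\infty$.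
   Context: Setting. $\Omega=\{1,\dots,M\}\times\{1,\dots,N\}$, $X=\mathbb{R}^\Omega$ and $Y=X^2$ with their standard Euclidean inner products. $\nabla u=(\nabla_1u,\nabla_2u)\in Y$, with $(\nabla_1u)_{i,j}=u_{i+1,j}-u_{i,j}$ for $i<M$ and $0$ for $i=M$; $(\nabla_2u)_{i,j}=u_{i,j+1}-u_{i,j}$ for $j<N$ and $0$ for $j=N$; $\mathrm{div}=-\nabla^*$. For $p\in Y$ write $p_{i,j}=((p_1)_{i,j},(p_2)_{i,j})\in\mathbb{R}^2$ and $|\cdot|$ for the Euclidean norm. $K$ is a linear operator on $X$, $z\in X$ the data, $\mu\ge0$, $\alpha>0$, $f=K^*z$, and $H=\mu\nabla^*\nabla+K^*K$ is assumed positive definite; $\|v\|_{H^{-1}}^2=\langle H^{-1}v,v\rangle$. Isotropic norm: $\|p\|_1=\sum_{(i,j)\in\Omega}|p_{i,j}|$; $\|\lambda\|_\infty=\max_{(i,j)\in\Omega}|\lambda_{i,j}|$. Dual problem: minimize $d(\lambda)=\frac12\|\mathrm{div}\,\lambda+f\|_{H^{-1}}^2-\frac12\|z\|_2^2+\mathcal{I}_{\{\|\lambda\|_\infty\le\alpha\}}(\lambda)$ over $\lambda\in Y$, $\mathcal I$ being the indicator function; $\mathcal{X}^I$ is its solution set. Assumption (SC) for a dual solution $\bar\lambda$: put $\bar g=-\nabla H^{-1}(\mathrm{div}\,\bar\lambda+f)\in Y$ (the gradient at $\bar\lambda$ of the smooth part of $d$). For every pixel $(i,j)$, either $|\bar\lambda_{i,j}|=\alpha$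 and $\bar g_{i,j}\ne0$ with $-\bar g_{i,j}\in\mathcal{N}_{\mathbb{B}_\alpha(0)}(\bar\lambda_{i,j})$, or $|\bar\lambda_{i,j}|<\alpha$. Here $\mathbb{B}_\alpha(0)$ is the closed Euclidean ball in $\mathbb{R}^2$ and $\mathcal{N}$ its normal cone. Augmented Lagrangian: $\Phi_k(u,p)=L(u,p;\lambda^k)=D(u)+\alpha\|p\|_1+\langle\lambda^k,\nabla u-p\rangle+\frac{\sigma_k}{2}\|\nabla u-p\|_2^2$. Algorithm. Given $\lambda^0\in Y$ and positive nondecreasing step sizes $\sigma_k\to\sigma_\infty<+\infty$, for $k=0,1,\dots$: compute $u^{k+1}$ as an approximate minimizer in $u$ of $\min_p\Phi_k(u,p)$, by applying an inner semismooth Newton method to its optimality condition $Hu-f+\nabla^*\mathcal{P}_\alpha(\lambda^k+\sigma_k\nabla u)=0$ until the stopping criteria below hold; then set $p^{k+1}=S_{\alpha/\sigma_k}(\lambda^k/\sigma_k+\nabla u^{k+1})$ and $\lambda^{k+1}=\lambda^k+\sigma_k(\nabla u^{k+1}-p^{k+1})=\mathcal{P}_\alpha(\lambda^k+\sigma_k\nabla u^{k+1})$. Here $\mathcal{P}_\alpha$ is the orthogonal projection onto $\{\|\lambda\|_\infty\le\alpha\}$ and $S_a=(I+a\,\partial\|\cdot\|_1)^{-1}$ is the soft thresholding operator. Inner solvers: ALM-PDP and ALM-PDD apply a primal-dual semismooth Newton method to the equivalent system in $(u,h)$ with auxiliary variable $h=\mathcal{P}_\alpha(\lambda^k+\sigma_k\nabla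 u)$, eliminating $h$ (PDP) or $u$ (PDD) from each Newton system and projecting $h$ onto $\{\|h\|_\infty\le\alpha\}$ after each step; ALM-PT applies semismooth Newton with Armijo line search directly to the equation in $u$ written with the soft thresholding operator. The inner solver enters the statement only as the means of producing a $u^{k+1}$ satisfying the stopping criteria. Stopping criteria: (A) $\Phi_k(u^{k+1},p^{k+1})-\inf\Phi_k\le\epsilon_k^2/(2\sigma_k)$, $\epsilon_k\ge0$, $\sum_{k=0}^\infty\epsilon_k<\infty$; (B1) $\Phi_k(u^{k+1},p^{k+1})-\inf\Phi_k\le\frac{\delta_k^2}{2\sigma_k}\|\lambda^{k+1}-\lambda^k\|^2$, $\delta_k\ge0$, $\sum_{k=0}^\infty\delta_k<\infty$. Metric subregularity: a set-valued map $F$ is metrically subregular at $\bar x$ for $\bar y$ with modulus $\kappa\ge0$ if $\bar y\in F(\bar x)$ and there are neighborhoods $U$ of $\bar x$, $V$ of $\bar y$ with $\mathrm{dist}(x,F^{-1}(\bar y))\le\kappa\,\mathrm{dist}(\bar y,F(x)\cap V)$ for all $x\in U$ (with $\mathrm{dist}(\cdot,\emptyset)=+\infty$). *)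

theory Defs
  imports "HOL-Analysis.Analysis"
begin

(* The pixel grid {1..M} x {1..N} is represented by two finite linearly ordered index types:
   up to order isomorphism, 'm is {1..CARD('m)} and 'n is {1..CARD('n)}, so that the type
   variables play the role of M and N. The norm and inner product of real^'n^'m and of the product
   space are the Euclidean ones. *)
type_synonym ('m, 'n) img = "real^'n^'m"
type_synonym ('m, 'n) field = "('m, 'n) img \<times> ('m, 'n) img"

definition is_last :: "'i::{finite,linorder} \<Rightarrow> bool" where
  "is_last i \<longleftrightarrow> i = Max UNIV"

(* The successor i + 1; only meaningful if i is not the last index. *)
definition next_idx :: "'i::{finite,linorder} \<Rightarrow> 'i" where
  "next_idx i = Min {j. i < j}"

definition grad :: "('m::{finite,linorder}, 'n::{finite,linorder}) img \<Rightarrow> ('m, 'n) field" where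
  "grad u =
    ((\<chi> i j. if is_last i then 0 else u $ next_idx i $ j - u $ i $ j),
     (\<chi> i j. if is_last j then 0 else u $ i $ next_idx j - u $ i $ j))"

definition divg :: "('m::{finite,linorder}, 'n::{finite,linorder}) field \<Rightarrow> ('m, 'n) img" where
  "divg p = - adjoint grad p"

definition pixel :: "('m::finite, 'n::finite) field \<Rightarrow> 'm \<Rightarrow> 'n \<Rightarrow> real \<times> real" where
  "pixel p i j = (fst p $ i $ j, snd p $ i $ j)"

definition norm_one :: "('m::finite, 'n::finite) field \<Rightarrow> real" where
  "norm_one p = (\<Sum>i\<in>UNIV. \<Sum>j\<in>UNIV. norm (pixel p i j))"

definition norm_max :: "('m::finite, 'n::finite) field \<Rightarrow> real" where
  "norm_max p = Max {norm (pixel p i j) | i j. True}"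

definition ind_fun :: "'a set \<Rightarrow> 'a \<Rightarrow> ereal" where
  "ind_fun S x = (if x \<in> S then 0 else \<infinity>)"

definition minimizers :: "('a \<Rightarrow> 'b::order) \<Rightarrow> 'a set" where
  "minimizers F = {x. \<forall>y. F x \<le> F y}"

definition subdiff :: "('a::real_inner \<Rightarrow> ereal) \<Rightarrow> 'a \<Rightarrow> 'a set" where
  "subdiff F x = {g. \<bar>F x\<bar> \<noteq> \<infinity> \<and> (\<forall>y. F x + ereal (g \<bullet> (y - x)) \<le> F y)}"

definition normal_cone :: "'a::real_inner set \<Rightarrow> 'a \<Rightarrow> 'a set" where
  "normal_cone S x = {v. x \<in> S \<and> (\<forall>y\<in>S. v \<bullet> (y - x) \<le> 0)}"

(* The value +\<infinity> of the distance from y to the empty set makes the inequality void when F x \<inter> V is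
   empty (also for \<kappa> = 0); this is the guard below, needed because infdist y {} = 0. *)
definition metrically_subregular ::
  "('a::metric_space \<Rightarrow> 'b::metric_space set) \<Rightarrow> 'a \<Rightarrow> 'b \<Rightarrow> real \<Rightarrow> bool" where
  "metrically_subregular F x0 y0 \<kappa> \<longleftrightarrow>
    0 \<le> \<kappa> \<and> y0 \<in> F x0 \<and>
    (\<exists>U V. open U \<and> x0 \<in> U \<and> open V \<and> y0 \<in> V \<and>
      (\<forall>x\<in>U. F x \<inter> V \<noteq> {} \<longrightarrow>
        infdist x {x'. y0 \<in> F x'} \<le> \<kappa> * infdist y0 (F x \<inter> V)))"

(* The resolvent (I + a \<partial>norm_one)^{-1}, which is single-valued on the whole space for a > 0. *)
definition soft_thresh ::
  "real \<Rightarrow> ('m::finite, 'n::finite) field \<Rightarrow> ('m, 'n) field" where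
  "soft_thresh a x = (THE p. \<exists>g\<in>subdiff (\<lambda>q. ereal (norm_one q)) p. x = p + a *\<^sub>R g)"

definition data_term ::
  "(('m::{finite,linorder}, 'n::{finite,linorder}) img \<Rightarrow> ('m, 'n) img) \<Rightarrow> ('m, 'n) img
    \<Rightarrow> real \<Rightarrow> ('m, 'n) img \<Rightarrow> real" where
  "data_term K z \<mu> u = 1 / 2 * (norm (K u - z))\<^sup>2 + \<mu> / 2 * (norm (grad u))\<^sup>2"

definition primal_obj ::
  "(('m::{finite,linorder}, 'n::{finite,linorder}) img \<Rightarrow> ('m, 'n) img) \<Rightarrow> ('m, 'n) img
    \<Rightarrow> real \<Rightarrow> real \<Rightarrow> ('m, 'n) img \<Rightarrow> real" where
  "primal_obj K z \<mu> \<alpha> u = data_term K z \<mu> u + \<alpha> * norm_one (grad u)"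

definition Hop ::
  "(('m::{finite,linorder}, 'n::{finite,linorder}) img \<Rightarrow> ('m, 'n) img)
    \<Rightarrow> real \<Rightarrow> ('m, 'n) img \<Rightarrow> ('m, 'n) img" where
  "Hop K \<mu> u = \<mu> *\<^sub>R adjoint grad (grad u) + adjoint K (K u)"

definition pos_def :: "('a::real_inner \<Rightarrow> 'a) \<Rightarrow> bool" where
  "pos_def A \<longleftrightarrow> (\<forall>v. v \<noteq> 0 \<longrightarrow> 0 < A v \<bullet> v)"

definition dual_obj ::
  "(('m::{finite,linorder}, 'n::{finite,linorder}) img \<Rightarrow> ('m, 'n) img) \<Rightarrow> ('m, 'n) img
    \<Rightarrow> real \<Rightarrow> real \<Rightarrow> ('m, 'n) field \<Rightarrow> ereal" where
  "dual_obj K z \<mu> \<alpha> l =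
    (let v = divg l + adjoint K z in
      ereal (1 / 2 * (inv (Hop K \<mu>) v \<bullet> v) - 1 / 2 * (norm z)\<^sup>2)
        + ind_fun {q. norm_max q \<le> \<alpha>} l)"

definition dual_grad ::
  "(('m::{finite,linorder}, 'n::{finite,linorder}) img \<Rightarrow> ('m, 'n) img) \<Rightarrow> ('m, 'n) img
    \<Rightarrow> real \<Rightarrow> ('m, 'n) field \<Rightarrow> ('m, 'n) field" where
  "dual_grad K z \<mu> l = - grad (inv (Hop K \<mu>) (divg l + adjoint K z))"

definition strict_compl ::
  "(('m::{finite,linorder}, 'n::{finite,linorder}) img \<Rightarrow> ('m, 'n) img) \<Rightarrow> ('m, 'n) img
    \<Rightarrow> real \<Rightarrow> real \<Rightarrow> ('m, 'n) field \<Rightarrow> bool" where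
  "strict_compl K z \<mu> \<alpha> l \<longleftrightarrow>
    (\<forall>i j. let g = pixel (dual_grad K z \<mu> l) i j in
      norm (pixel l i j) = \<alpha> \<and> g \<noteq> 0 \<and> - g \<in> normal_cone (cball 0 \<alpha>) (pixel l i j)
      \<or> norm (pixel l i j) < \<alpha>)"

definition aug_lagr ::
  "(('m::{finite,linorder}, 'n::{finite,linorder}) img \<Rightarrow> ('m, 'n) img) \<Rightarrow> ('m, 'n) img
    \<Rightarrow> real \<Rightarrow> real \<Rightarrow> real \<Rightarrow> ('m, 'n) field \<Rightarrow> ('m, 'n) img \<Rightarrow> ('m, 'n) field \<Rightarrow> real" where
  "aug_lagr K z \<mu> \<alpha> s l u p =
    data_term K z \<mu> u + \<alpha> * norm_one p + l \<bullet> (grad u - p) + s / 2 * (norm (grad u - p))\<^sup>2"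

definition alm_gap ::
  "(('m::{finite,linorder}, 'n::{finite,linorder}) img \<Rightarrow> ('m, 'n) img) \<Rightarrow> ('m, 'n) img
    \<Rightarrow> real \<Rightarrow> real \<Rightarrow> real \<Rightarrow> ('m, 'n) field \<Rightarrow> ('m, 'n) img \<Rightarrow> ('m, 'n) field \<Rightarrow> real" where
  "alm_gap K z \<mu> \<alpha> s l u p =
    aug_lagr K z \<mu> \<alpha> s l u p - (INF (v, q)\<in>UNIV. aug_lagr K z \<mu> \<alpha> s l v q)"

definition rate :: "real \<Rightarrow> real \<Rightarrow> real \<Rightarrow> real" where
  "rate \<kappa> s \<delta> = (\<kappa> * (\<kappa>\<^sup>2 + s\<^sup>2) powr (- 1 / 2) + \<delta>) * inverse (1 - \<delta>)"

end

(* Up to the error allowed by the stopping criterion, the augmented Lagrangian method is the proximal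
   point method for the dual problem. The exact proximal point b of d at l yields the exact minimizer
   (u, p) of the augmented Lagrangian, namely u = H^{-1} (div b + f) and p = grad u - (b - l) / sigma,
   and for all (v, q)
     Phi (v, q) - Phi (u, p) >= <H (v - u), v - u> / 2 + |l' - b|^2 / (2 sigma),
   where l' = l + sigma (grad v - q). So criterion (A) bounds |l' - b| by a summable sequence, and it
   also forces v - u to 0. Convergence follows from firm nonexpansiveness of the resolvent
   (quasi-Fejer monotonicity), and the linear rate from metric subregularity.

   For the subregularity: at a dual solution a pixel with a nonzero gradient lies on the circle of
   radius alpha, opposite to the gradient, and by strict complementarity these are all the active
   pixels. As the disc is strongly convex there, d grows quadratically in the active pixels; it also
   grows quadratically in div. Near the solution the solution set is the affine space on which div
   and the active pixels are fixed, so the distance to it is bounded by these two quantities. *)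

theory Submission
  imports Defs
begin

section \<open>Images and fields\<close>

lemma linear_grad: "linear grad"
  by (rule linearI) (auto simp: grad_def prod_eq_iff vec_eq_iff algebra_simps)

lemma inner_divg: "divg q \<bullet> v = - (q \<bullet> grad v)"
  by (simp add: divg_def adjoint_clauses[OF linear_grad] inner_minus_left)

lemma linear_divg: "linear divg"
  using linear_compose_neg[OF adjoint_linear[OF linear_grad]] by (simp add: divg_def[abs_def])

lemma pixel_simps [simp]:
  "pixel 0 i j = 0"
  "pixel (p + q) i j = pixel p i j + pixel q i j"
  "pixel (p - q) i j = pixel p i j - pixel q i j"
  "pixel (- p) i j = - pixel p i j"
  "pixel (c *\<^sub>R p) i j = c *\<^sub>R pixel p i j"
  by (auto simp: pixel_def zero_prod_def)

lemma inner_field: "p \<bullet> q = (\<Sum>i\<in>UNIV. \<Sum>j\<in>UNIV. pixel p i j \<bullet> pixel q i j)"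
  by (simp add: inner_prod_def inner_vec_def pixel_def sum.distrib)

lemma norm_pixel_le: "norm (pixel p i j) \<le> norm p"
proof (rule power2_le_imp_le)
  have "(norm (pixel p i j))\<^sup>2 \<le> (\<Sum>j\<in>UNIV. (norm (pixel p i j))\<^sup>2)"
    by (rule member_le_sum) auto
  also have "\<dots> \<le> (\<Sum>i\<in>UNIV. \<Sum>j\<in>UNIV. (norm (pixel p i j))\<^sup>2)"
    by (rule member_le_sum) (auto intro: sum_nonneg)
  finally show "(norm (pixel p i j))\<^sup>2 \<le> (norm p)\<^sup>2"
    by (simp add: power2_norm_eq_inner inner_field)
qed simp

definition field_of :: "('m::finite \<Rightarrow> 'n::finite \<Rightarrow> real \<times> real) \<Rightarrow> ('m, 'n) field" where
  "field_of F = ((\<chi> i j. fst (F i j)), (\<chi> i j. snd (F i j)))"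

lemma pixel_field_of [simp]: "pixel (field_of F) i j = F i j"
  by (simp add: field_of_def pixel_def)

definition restrict_field :: "('m::finite \<Rightarrow> 'n::finite \<Rightarrow> bool) \<Rightarrow> ('m, 'n) field \<Rightarrow> ('m, 'n) field" where
  "restrict_field A p = field_of (\<lambda>i j. if A i j then pixel p i j else 0)"

lemma pixel_restrict [simp]: "pixel (restrict_field A p) i j = (if A i j then pixel p i j else 0)"
  by (simp add: restrict_field_def)

lemma pixel_eqI: "(\<And>i j. pixel p i j = pixel q i j) \<Longrightarrow> p = q"
  by (simp add: pixel_def prod_eq_iff vec_eq_iff)

lemma linear_restrict: "linear (restrict_field A)"
  by (rule linearI; rule pixel_eqI) auto

lemma norm_max_le_iff: "norm_max p \<le> a \<longleftrightarrow> (\<forall>i j. norm (pixel p i j) \<le> a)"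
proof -
  have "{norm (pixel p i j) | i j. True} = range (\<lambda>(i, j). norm (pixel p i j))"
    by auto
  then have "finite {norm (pixel p i j) | i j. True}" "{norm (pixel p i j) | i j. True} \<noteq> {}"
    by simp_all
  then show ?thesis
    unfolding norm_max_def by (subst Max_le_iff) auto
qed

section \<open>The dual feasible set and its support function\<close>

definition dual_ball :: "real \<Rightarrow> ('m::finite, 'n::finite) field set" where
  "dual_ball a = {q. norm_max q \<le> a}"

lemma mem_dual_ball: "q \<in> dual_ball a \<longleftrightarrow> (\<forall>i j. norm (pixel q i j) \<le> a)"
  by (simp add: dual_ball_def norm_max_le_iff)

lemma convex_dual_ball: "convex (dual_ball a :: ('m::finite, 'n::finite) field set)"
proof (rule convexI)
  fix x y :: "('m, 'n) field" and s t :: real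
  assume *: "x \<in> dual_ball a" "y \<in> dual_ball a" "0 \<le> s" "0 \<le> t" "s + t = 1"
  have "norm (pixel (s *\<^sub>R x + t *\<^sub>R y) i j) \<le> a" for i j
  proof -
    have "pixel x i j \<in> cball 0 a" "pixel y i j \<in> cball 0 a"
      using * by (auto simp: mem_dual_ball)
    from convexD[OF convex_cball this] * show ?thesis
      by simp
  qed
  then show "s *\<^sub>R x + t *\<^sub>R y \<in> dual_ball a"
    by (simp add: mem_dual_ball)
qed

lemma continuous_pixel: "continuous_on S (\<lambda>q. pixel q i j)"
  unfolding pixel_def by (intro continuous_intros)

lemma compact_dual_ball: "compact (dual_ball a :: ('m::finite, 'n::finite) field set)"
proof -
  have "closed (dual_ball a :: ('m, 'n) field set)"
  proof -
    have "(dual_ball a :: ('m, 'n) field set) = (\<Inter>i. \<Inter>j. {q. norm (pixel q i j) \<le> a})"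
      by (auto simp: mem_dual_ball)
    also have "closed \<dots>"
      by (intro closed_INT ballI closed_Collect_le continuous_on_norm continuous_pixel continuous_on_const)
    finally show ?thesis .
  qed
  moreover have "bounded (dual_ball a :: ('m, 'n) field set)"
  proof (rule boundedI)
    fix q :: "('m, 'n) field" assume q: "q \<in> dual_ball a"
    have "(norm q)\<^sup>2 \<le> (\<Sum>i\<in>(UNIV::'m set). \<Sum>j\<in>(UNIV::'n set). a\<^sup>2)"
      unfolding power2_norm_eq_inner inner_field
      using q by (intro sum_mono) (simp add: mem_dual_ball power_mono flip: power2_norm_eq_inner)
    then show "norm q \<le> sqrt (\<Sum>i\<in>(UNIV::'m set). \<Sum>j\<in>(UNIV::'n set). a\<^sup>2)"
      by (rule real_le_rsqrt)
  qed
  ultimately show ?thesis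
    by (simp add: compact_eq_bounded_closed)
qed

text \<open>One half of the duality between \<open>norm_max\<close> and \<open>norm_one\<close>:
  Cauchy-Schwarz at each pixel, then summation.\<close>

lemma inner_le_norm_one:
  assumes "q \<in> dual_ball a"
  shows "q \<bullet> p \<le> a * norm_one p"
proof -
  have "pixel q i j \<bullet> pixel p i j \<le> a * norm (pixel p i j)" for i j
    using assms norm_cauchy_schwarz[of "pixel q i j" "pixel p i j"]
    by (meson mem_dual_ball mult_right_mono norm_ge_zero order_trans)
  then show ?thesis
    unfolding inner_field norm_one_def sum_distrib_left by (intro sum_mono)
qed

text \<open>The other half. The hypothesis says that no point of the ball has a larger inner product
  with \<open>p\<close> than \<open>l\<close> has; comparing with the field whose pixels have length
  \<open>a\<close> and point along those of \<open>p\<close> (zero where \<open>p\<close> vanishes)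
  gives the bound.\<close>

lemma norm_one_le_inner:
  assumes "\<And>q. q \<in> dual_ball a \<Longrightarrow> p \<bullet> (q - l) \<le> 0" "0 < a"
  shows "a * norm_one p \<le> l \<bullet> p"
proof -
  let ?q = "field_of (\<lambda>i j. a *\<^sub>R sgn (pixel p i j))"
  have "?q \<in> dual_ball a"
    using \<open>0 < a\<close> by (auto simp: mem_dual_ball norm_sgn)
  then have "?q \<bullet> p \<le> l \<bullet> p"
    using assms(1)[of ?q] by (simp add: inner_diff_right inner_commute)
  moreover have "sgn x \<bullet> x = norm x" for x :: "real \<times> real"
    by (cases "x = 0") (simp_all add: sgn_div_norm power2_eq_square flip: power2_norm_eq_inner)
  then have "?q \<bullet> p = a * norm_one p"
    by (simp add: inner_field norm_one_def sum_distrib_left)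
  ultimately show ?thesis
    by simp
qed

section \<open>Euclidean auxiliary results\<close>

lemma power2_norm_add:
  fixes a b :: "'a::real_inner"
  shows "(norm (a + b))\<^sup>2 = (norm a)\<^sup>2 + 2 * (a \<bullet> b) + (norm b)\<^sup>2"
  by (simp add: power2_norm_eq_inner inner_add_left inner_add_right inner_commute)

text \<open>Gives one constant for all pixels at which a quantity is positive, leaving out those
  where it vanishes. It serves for the gradient at active pixels and for the slack at inactive
  ones.\<close>

lemma finite_positive_lower_bound:
  fixes F :: "'a::finite \<Rightarrow> 'b::finite \<Rightarrow> real"
  obtains c where "0 < c" "\<And>i j. 0 < F i j \<Longrightarrow> c \<le> F i j"
proof
  \<comment> \<open>The extra element 1 keeps the minimum meaningful when no value of
    \<open>F\<close> is positive.\<close>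
  let ?S = "insert 1 {F i j | i j. 0 < F i j}"
  have "?S \<subseteq> insert 1 (range (\<lambda>(i, j). F i j))"
    by auto
  then have fin: "finite ?S"
    by (rule finite_subset) simp
  then show "0 < Min ?S"
    by (subst Min_gr_iff) auto
  show "Min ?S \<le> F i j" if "0 < F i j" for i j
    using fin that by (intro Min_le) auto
qed

text \<open>Equality in Cauchy-Schwarz forces \<open>a *\<^sub>R g = - (norm g *\<^sub>R l)\<close>,
  so the linear term becomes a multiple of \<open>a\<^sup>2 - l \<bullet> x\<close>. Expanding the
  square of \<open>norm (x - l)\<close> with \<open>norm x \<le> a\<close> shows that it is at most
  twice this quantity.\<close>

lemma ball_boundary_growth:
  fixes g l x :: "'a::real_inner"
  assumes "a * norm g = - (l \<bullet> g)" "norm l = a" "0 < a" "norm x \<le> a"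
  shows "norm g / (2 * a) * (norm (x - l))\<^sup>2 \<le> g \<bullet> (x - l)"
proof -
  have "l \<bullet> (- g) = norm l * norm (- g)"
    using assms by simp
  then have "norm l *\<^sub>R (- g) = norm (- g) *\<^sub>R l"
    by (rule norm_cauchy_schwarz_eq[THEN iffD1])
  then have "a *\<^sub>R g = - (norm g *\<^sub>R l)"
    using assms by (metis minus_equation_iff norm_minus_cancel scaleR_minus_right)
  then have "a * (g \<bullet> (x - l)) = - (norm g * (l \<bullet> (x - l)))"
    by (metis inner_minus_left inner_scaleR_left)
  also have "\<dots> = norm g * (a\<^sup>2 - l \<bullet> x)"
    using assms(2) by (simp add: inner_diff_right power2_norm_eq_inner[symmetric] algebra_simps)
  also have "\<dots> \<ge> norm g * ((norm (x - l))\<^sup>2 / 2)"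
  proof (intro mult_left_mono norm_ge_zero)
    have "(norm x)\<^sup>2 \<le> a\<^sup>2"
      using assms(3,4) by (intro power_mono) auto
    moreover have "(norm (x - l))\<^sup>2 = (norm x)\<^sup>2 - 2 * (l \<bullet> x) + a\<^sup>2"
      using assms(2) by (auto simp: power2_norm_eq_inner algebra_simps inner_commute)
    ultimately show "(norm (x - l))\<^sup>2 / 2 \<le> a\<^sup>2 - l \<bullet> x" by linarith
  qed
  finally show ?thesis
    using assms(3) by (simp add: field_simps)
qed

text \<open>The quadratic form attains a positive minimum on the compact unit sphere, and
  homogeneity of degree two carries the bound to all vectors.\<close>

lemma pos_def_coercive:
  fixes A :: "'a::euclidean_space \<Rightarrow> 'a"
  assumes "linear A" "pos_def A"
  obtains c where "0 < c" "\<And>v. c * (norm v)\<^sup>2 \<le> A v \<bullet> v"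
proof (cases "sphere (0::'a) 1 = {}")
  case True
  have "v = 0" for v :: 'a
  proof (rule ccontr)
    assume "v \<noteq> 0"
    then have "sgn v \<in> sphere 0 1"
      by (simp add: norm_sgn)
    with True show False by blast
  qed
  then have "1 * (norm v)\<^sup>2 \<le> A v \<bullet> v" for v
    by (metis inner_zero_right mult_zero_right norm_zero order_refl power_zero_numeral)
  with that show ?thesis using zero_less_one by blast
next
  case False
  have "continuous_on (sphere 0 1) (\<lambda>v. A v \<bullet> v)"
    by (intro continuous_intros linear_continuous_on) (simp add: assms(1) linear_conv_bounded_linear[symmetric])
  from continuous_attains_inf[OF compact_sphere False this]
  obtain w where w: "w \<in> sphere 0 1" "\<And>v. v \<in> sphere 0 1 \<Longrightarrow> A w \<bullet> w \<le> A v \<bullet> v"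
    by blast
  show ?thesis
  proof (rule that)
    show "0 < A w \<bullet> w"
      using assms(2) w(1) unfolding pos_def_def by (metis mem_sphere_0 norm_zero zero_neq_one)
    fix v :: 'a
    show "A w \<bullet> w * (norm v)\<^sup>2 \<le> A v \<bullet> v"
    proof (cases "v = 0")
      case False
      then have "A w \<bullet> w \<le> A (v /\<^sub>R norm v) \<bullet> (v /\<^sub>R norm v)"
        by (intro w(2)) simp
      also have "\<dots> = A v \<bullet> v / (norm v)\<^sup>2"
        by (simp add: linear_cmul[OF assms(1)] power2_eq_square field_simps)
      finally show ?thesis
        using False by (simp add: field_simps)
    qed (simp add: linear_0[OF assms(1)])
  qed
qed

text \<open>Divide by \<open>t\<close> and let \<open>t\<close> decrease to 0. This turns
  comparisons of function values along a segment into first-order variational inequalities.\<close>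

lemma le_zero_if_le_quadratic:
  fixes a c :: real
  assumes "\<And>t. 0 < t \<Longrightarrow> t \<le> 1 \<Longrightarrow> t * a \<le> t\<^sup>2 * c"
  shows "a \<le> 0"
proof (rule tendsto_lowerbound)
  show "((\<lambda>t. t * c) \<longlongrightarrow> 0) (at_right 0)"
    by (auto intro!: tendsto_eq_intros)
  show "\<forall>\<^sub>F t in at_right 0. a \<le> t * c"
    using eventually_at_right_real[OF zero_less_one]
    by (rule eventually_mono) (use assms in \<open>force simp: power2_eq_square mult.assoc\<close>)
qed simp

text \<open>Subtracting the partial sums of the errors leaves a decreasing sequence, bounded below
  by minus the total error.\<close>

lemma quasi_fejer_convergent:
  fixes a e :: "nat \<Rightarrow> real"
  assumes "\<And>k. 0 \<le> a k" "\<And>k. a (Suc k) \<le> a k + e k" "summable e" "\<And>k. 0 \<le> e k"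
  shows "convergent a"
proof -
  define b where "b k = a k - sum e {..<k}" for k
  have "decseq b"
    by (rule decseq_SucI) (use assms(2) in \<open>simp add: b_def algebra_simps\<close>)
  moreover have "- suminf e \<le> b k" for k
    using sum_le_suminf[OF assms(3), of "{..<k}"] assms(1)[of k] assms(4) by (simp add: b_def)
  ultimately obtain L where "b \<longlonglongrightarrow> L"
    using decseq_convergent by blast
  with summable_LIMSEQ[OF assms(3)] have "(\<lambda>k. b k + sum e {..<k}) \<longlonglongrightarrow> L + suminf e"
    by (intro tendsto_add)
  then show ?thesis
    by (auto simp: b_def convergent_def)
qed

text \<open>The witness is the orthogonal projection of \<open>x\<close> onto the kernel:
  \<open>L\<close> is injective, hence bounded below, on the orthogonal complement. The bound
  \<open>norm w \<le> norm x\<close> is recorded because it later keeps a shifted dual solution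
  feasible.\<close>

lemma kernel_error_bound:
  fixes L :: "'a::euclidean_space \<Rightarrow> 'b::euclidean_space"
  assumes "linear L"
  obtains c where "0 < c"
    "\<And>x. \<exists>w. L w = 0 \<and> norm w \<le> norm x \<and> c * norm (x - w) \<le> norm (L x)"
proof -
  define S where "S = {x. L x = 0}"
  define R where "R = {y. \<forall>x\<in>S. orthogonal x y}"
  have S: "span S = S"
    unfolding S_def by (intro span_eq_iff[THEN iffD2] linear_subspace_kernel assms)
  have R: "subspace R"
    unfolding R_def by (rule subspace_orthogonal_to_vectors)
  have "\<forall>x\<in>R. L x = 0 \<longrightarrow> x = 0"
    by (auto simp: R_def S_def orthogonal_self)
  with R obtain e where e: "0 < e" "\<And>x. x \<in> R \<Longrightarrow> e * norm x \<le> norm (L x)"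
    using injective_imp_isometric[of R L] closed_subspace[OF R] assms
    by (auto simp: linear_conv_bounded_linear)
  show thesis
  proof (rule that[OF e(1)])
    fix x
    obtain y w where yw: "y \<in> S" "\<And>v. v \<in> S \<Longrightarrow> orthogonal w v" "x = y + w"
      using orthogonal_subspace_decomp_exists[of S x] S by metis
    have "L (x - y) = L x"
      using yw(1) by (simp add: S_def linear_diff[OF assms])
    moreover have "x - y \<in> R"
      using yw by (simp add: R_def orthogonal_commute)
    moreover have "(norm y)\<^sup>2 \<le> (norm x)\<^sup>2"
      using norm_add_Pythagorean[of y w] yw by (simp add: orthogonal_commute)
    ultimately show "\<exists>y. L y = 0 \<and> norm y \<le> norm x \<and> e * norm (x - y) \<le> norm (L x)"
      using e(2)[of "x - y"] yw(1) by (auto simp: S_def intro!: exI[of _ y] power2_le_imp_le)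
  qed
qed

section \<open>The inexact proximal point method\<close>

lemma tendsto_zero_if_square_le:
  fixes a b :: "nat \<Rightarrow> real"
  assumes "\<And>k. (a k)\<^sup>2 \<le> b k" "b \<longlonglongrightarrow> 0"
  shows "a \<longlonglongrightarrow> 0"
proof -
  have "(\<lambda>k. (a k)\<^sup>2) \<longlonglongrightarrow> 0"
    by (rule tendsto_sandwich[OF _ _ tendsto_const assms(2)]) (simp_all add: assms(1))
  from tendsto_real_sqrt[OF this] show ?thesis
    by (simp add: tendsto_rabs_zero_iff)
qed

lemma tendsto_scaleR_inverse_zero:
  fixes X :: "nat \<Rightarrow> 'a::real_normed_vector" and \<sigma> :: "nat \<Rightarrow> real"
  assumes "X \<longlonglongrightarrow> 0" "0 < s" "\<And>k. s \<le> \<sigma> k"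
  shows "(\<lambda>k. X k /\<^sub>R \<sigma> k) \<longlonglongrightarrow> 0"
proof (rule Lim_null_comparison)
  have "norm (X k /\<^sub>R \<sigma> k) \<le> norm (X k) / s" for k
    using assms(2) assms(3)[of k]
    by (simp add: divide_inverse_commute) (intro mult_right_mono le_imp_inverse_le; simp)
  then show "\<forall>\<^sub>F k in sequentially. norm (X k /\<^sub>R \<sigma> k) \<le> norm (X k) / s"
    by simp
  show "(\<lambda>k. norm (X k) / s) \<longlonglongrightarrow> 0"
    using tendsto_divide[OF tendsto_norm_zero[OF assms(1)] tendsto_const, of s] assms(2) by simp
qed

text \<open>Here \<open>y\<close> is the resolvent of \<open>x\<close> and \<open>w\<close> a zero
  of the operator. The term \<open>- 0\<close> is the element 0 of the operator at \<open>w\<close>,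
  which gives the hypothesis the shape in which monotonicity delivers it.\<close>

lemma monotone_resolvent_pythagoras:
  fixes x y w :: "'a::real_inner"
  assumes "0 \<le> ((x - y) /\<^sub>R s - 0) \<bullet> (y - w)" "0 < s"
  shows "(dist y w)\<^sup>2 + (dist x y)\<^sup>2 \<le> (dist x w)\<^sup>2"
proof -
  have "0 \<le> (x - y) \<bullet> (y - w)"
    using assms by (simp add: zero_le_mult_iff)
  moreover have "(dist x w)\<^sup>2 = (dist y w)\<^sup>2 + (dist x y)\<^sup>2 + 2 * ((x - y) \<bullet> (y - w))"
    by (simp add: dist_norm power2_norm_eq_inner algebra_simps inner_commute)
  ultimately show ?thesis by simp
qed

text \<open>The distances of \<open>x k\<close> to any zero converge by quasi-Fejer monotonicity, so
  the iterates are bounded, and the steps \<open>x k - y k\<close> vanish. Closedness of the graph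
  makes a cluster point a zero; its distance to \<open>x k\<close> converges and tends to 0 along a
  subsequence, hence altogether.\<close>

lemma inexact_proximal_point_converges:
  fixes T :: "'a::euclidean_space \<Rightarrow> 'a set"
  assumes mono: "\<And>x y v w. v \<in> T x \<Longrightarrow> w \<in> T y \<Longrightarrow> 0 \<le> (v - w) \<bullet> (x - y)"
    and clos: "\<And>X V x v. X \<longlonglongrightarrow> x \<Longrightarrow> V \<longlonglongrightarrow> v \<Longrightarrow> (\<And>n::nat. V n \<in> T (X n)) \<Longrightarrow> v \<in> T x"
    and zero: "0 \<in> T x0"
    and s: "0 < s" "\<And>k. s \<le> \<sigma> k"
    and prox: "\<And>k. (x k - y k) /\<^sub>R \<sigma> k \<in> T (y k)"
    and err: "\<And>k. dist (x (Suc k)) (y k) \<le> e k" "summable e"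
  obtains x' where "0 \<in> T x'" "x \<longlonglongrightarrow> x'" "y \<longlonglongrightarrow> x'"
proof -
  have \<sigma>: "0 < \<sigma> k" for k
    using s(1) s(2)[of k] by linarith
  have e: "0 \<le> e k" for k
    using err(1)[of k] zero_le_dist order_trans by blast
  have pyth: "(dist (y k) w)\<^sup>2 + (dist (x k) (y k))\<^sup>2 \<le> (dist (x k) w)\<^sup>2" if "0 \<in> T w" for w k
    using mono[OF prox that] \<sigma> by (rule monotone_resolvent_pythagoras)
  have le: "dist (y k) w \<le> dist (x k) w" if "0 \<in> T w" for w k
    using pyth[OF that, of k] zero_le_power2[of "dist (x k) (y k)"]
    by (intro power2_le_imp_le[of "dist (y k) w"] zero_le_dist) linarith
  have conv: "convergent (\<lambda>k. dist (x k) w)" if "0 \<in> T w" for w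
  proof (rule quasi_fejer_convergent[OF _ _ err(2) e])
    fix k
    show "dist (x (Suc k)) w \<le> dist (x k) w + e k"
      using le[OF that, of k] err(1)[of k] dist_triangle[of "x (Suc k)" w "y k"] by linarith
  qed simp
  have e0: "e \<longlonglongrightarrow> 0"
    by (rule summable_LIMSEQ_zero[OF err(2)])
  have xy: "(\<lambda>k. dist (x k) (y k)) \<longlonglongrightarrow> 0"
  proof -
    obtain d where d: "(\<lambda>k. dist (x k) x0) \<longlonglongrightarrow> d"
      using conv[OF zero] by (auto simp: convergent_def)
    have "(dist (x k) (y k))\<^sup>2 \<le> (dist (x k) x0)\<^sup>2 - (dist (x (Suc k)) x0)\<^sup>2 + e k * (2 * dist (x (Suc k)) x0)" for k
    \<comment> \<open>The lower bound \<open>dist (x (Suc k)) x0 - e k\<close> of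
      \<open>dist (y k) x0\<close> can be squared only if it is nonnegative; otherwise the error
      term absorbs the square of \<open>dist (x (Suc k)) x0\<close>.\<close>
    proof (cases "dist (x (Suc k)) x0 \<le> e k")
      case True
      have "dist (x (Suc k)) x0 * dist (x (Suc k)) x0 \<le> e k * (2 * dist (x (Suc k)) x0)"
        using True e[of k] by (intro mult_mono) auto
      moreover have "(dist (x k) (y k))\<^sup>2 \<le> (dist (x k) x0)\<^sup>2"
        using pyth[OF zero, of k] by (smt (verit) zero_le_power2)
      ultimately show ?thesis
        by (simp add: power2_eq_square)
    next
      case False
      have "dist (x (Suc k)) x0 - e k \<le> dist (y k) x0"
        using err(1)[of k] dist_triangle[of "x (Suc k)" x0 "y k"] by linarith
      then have "(dist (x (Suc k)) x0 - e k)\<^sup>2 \<le> (dist (y k) x0)\<^sup>2"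
        using False by (intro power_mono) auto
      moreover have "(dist (x (Suc k)) x0 - e k)\<^sup>2 = (dist (x (Suc k)) x0)\<^sup>2 - e k * (2 * dist (x (Suc k)) x0) + (e k)\<^sup>2"
        by (simp add: power2_diff algebra_simps)
      moreover have "0 \<le> (e k)\<^sup>2" by simp
      ultimately show ?thesis
        using pyth[OF zero, of k] by linarith
    qed
    moreover
    have "(\<lambda>k. (dist (x k) x0)\<^sup>2 - (dist (x (Suc k)) x0)\<^sup>2 + e k * (2 * dist (x (Suc k)) x0)) \<longlonglongrightarrow> d\<^sup>2 - d\<^sup>2 + 0 * (2 * d)"
      by (intro tendsto_intros d e0 LIMSEQ_Suc)
    then have "(\<lambda>k. (dist (x k) x0)\<^sup>2 - (dist (x (Suc k)) x0)\<^sup>2 + e k * (2 * dist (x (Suc k)) x0)) \<longlonglongrightarrow> 0"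
      by simp
    ultimately show ?thesis
      by (rule tendsto_zero_if_square_le)
  qed
  have "bounded (range x)"
  proof -
    have "Bseq (\<lambda>k. dist (x k) x0)"
      using conv[OF zero] by (rule convergent_imp_Bseq)
    then obtain B where "\<And>k. dist (x k) x0 \<le> B"
      by (auto simp: Bseq_def)
    then show ?thesis
      by (auto simp: bounded_def dist_commute intro!: exI[of _ x0] exI[of _ B])
  qed
  then obtain x' r where r: "strict_mono r" "(x \<circ> r) \<longlonglongrightarrow> x'"
    using bounded_imp_convergent_subsequence by blast
  have xy0: "(\<lambda>k. x k - y k) \<longlonglongrightarrow> 0"
    using xy by (simp add: dist_norm tendsto_norm_zero_iff)
  have yr: "(\<lambda>n. y (r n)) \<longlonglongrightarrow> x'"
    using tendsto_diff[OF r(2) LIMSEQ_subseq_LIMSEQ[OF xy0 r(1)]] by (simp add: o_def)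
  have "(\<lambda>n. (x n - y n) /\<^sub>R \<sigma> n) \<longlonglongrightarrow> 0"
    using xy0 s by (rule tendsto_scaleR_inverse_zero)
  from LIMSEQ_subseq_LIMSEQ[OF this r(1)]
  have "(\<lambda>n. (x (r n) - y (r n)) /\<^sub>R \<sigma> (r n)) \<longlonglongrightarrow> 0"
    by (simp add: o_def)
  from clos[OF yr this prox] have T0: "0 \<in> T x'" .
  obtain d where d: "(\<lambda>k. dist (x k) x') \<longlonglongrightarrow> d"
    using conv[OF T0] by (auto simp: convergent_def)
  have "(\<lambda>k. dist (x (r k)) x') \<longlonglongrightarrow> d" "(\<lambda>k. dist (x (r k)) x') \<longlonglongrightarrow> 0"
    using LIMSEQ_subseq_LIMSEQ[OF d r(1)] tendsto_dist[OF r(2) tendsto_const, of x']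
    by (simp_all add: o_def)
  with d have "(\<lambda>k. dist (x k) x') \<longlonglongrightarrow> 0"
    using LIMSEQ_unique by blast
  then have x: "x \<longlonglongrightarrow> x'"
    by (rule tendsto_dist_iff[THEN iffD2])
  have "y \<longlonglongrightarrow> x'"
    using tendsto_diff[OF x xy0] by simp
  with T0 x show thesis by (rule that)
qed

text \<open>With \<open>r\<close> the length of the exact proximal step and \<open>D\<close>,
  \<open>E\<close> the distances of \<open>x k\<close>, \<open>y k\<close> to the zeros,
  subregularity gives E <= \<kappa> r / \<sigma> and the resolvent inequality gives E^2 + r^2 <=
  D^2. Eliminating r yields the factor \<kappa> / sqrt (\<kappa>^2 + \<sigma>^2) for exact steps;
  the inexactness enters through the triangle inequality.\<close>

lemma inexact_proximal_point_rate:
  fixes T :: "'a::euclidean_space \<Rightarrow> 'a set"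
  assumes mono: "\<And>x y v w. v \<in> T x \<Longrightarrow> w \<in> T y \<Longrightarrow> 0 \<le> (v - w) \<bullet> (x - y)"
    and clos: "closed {x. 0 \<in> T x}"
    and s: "0 < s" "\<And>k. s \<le> \<sigma> k"
    and prox: "\<And>k. (x k - y k) /\<^sub>R \<sigma> k \<in> T (y k)"
    and lim: "x \<longlonglongrightarrow> x'" "y \<longlonglongrightarrow> x'"
    and subreg: "metrically_subregular T x' 0 \<kappa>"
    and err: "\<And>k. dist (x (Suc k)) (y k) \<le> \<delta> k * dist (x (Suc k)) (x k)"
    and \<delta>: "\<And>k. 0 \<le> \<delta> k" "\<delta> \<longlonglongrightarrow> 0"
  shows "\<forall>\<^sub>F k in sequentially.
    infdist (x (Suc k)) {x. 0 \<in> T x} \<le> rate \<kappa> (\<sigma> k) (\<delta> k) * infdist (x k) {x. 0 \<in> T x}"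
proof -
  let ?S = "{x. 0 \<in> T x}"
  have \<sigma>: "0 < \<sigma> k" for k
    using s(1) s(2)[of k] by linarith
  obtain U V where UV: "open U" "x' \<in> U" "open V" "0 \<in> V"
    and sub: "\<And>x. x \<in> U \<Longrightarrow> T x \<inter> V \<noteq> {} \<Longrightarrow> infdist x ?S \<le> \<kappa> * infdist 0 (T x \<inter> V)"
    and \<kappa>: "0 \<le> \<kappa>" and ne: "x' \<in> ?S"
    using subreg unfolding metrically_subregular_def by blast
  have "(\<lambda>n. x n - y n) \<longlonglongrightarrow> 0"
    using tendsto_diff[OF lim] by simp
  from tendsto_scaleR_inverse_zero[OF this s]
  have "(\<lambda>n. (x n - y n) /\<^sub>R \<sigma> n) \<longlonglongrightarrow> 0" .
  \<comment> \<open>Eventually the residual lies in \<open>V\<close>, the point \<open>y k\<close>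
    lies in \<open>U\<close>, and \<open>\<delta> k < 1\<close>, so that division by
    \<open>1 - \<delta> k\<close> preserves order.\<close>
  from topological_tendstoD[OF this UV(3,4)] topological_tendstoD[OF lim(2) UV(1,2)]
    order_tendstoD(2)[OF \<delta>(2) zero_less_one]
  show ?thesis
  proof eventually_elim
    case (elim k)
    let ?r = "dist (x k) (y k)" and ?D = "infdist (x k) ?S" and ?E = "infdist (y k) ?S"
    have in_TV: "(x k - y k) /\<^sub>R \<sigma> k \<in> T (y k) \<inter> V"
      using prox elim by blast
    have "?E \<le> \<kappa> * infdist 0 (T (y k) \<inter> V)"
      using sub elim in_TV by blast
    also have "infdist 0 (T (y k) \<inter> V) \<le> dist 0 ((x k - y k) /\<^sub>R \<sigma> k)"
      using in_TV by (rule infdist_le)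
    finally have E: "?E \<le> \<kappa> * (?r / \<sigma> k)"
      using \<kappa> \<sigma>[of k] by (simp add: dist_norm mult_left_mono divide_inverse_commute)
    \<comment> \<open>A zero nearest to \<open>x k\<close>, so that the resolvent inequality at
      \<open>w\<close> has exactly \<open>?D\<close> on its right side.\<close>
    obtain w where w: "w \<in> ?S" "?D = dist (x k) w"
      using infdist_attains_inf[OF clos] ne by blast
    have pyth: "(dist (y k) w)\<^sup>2 + ?r\<^sup>2 \<le> ?D\<^sup>2"
      unfolding w(2) using mono[OF prox[of k], of 0 w] w(1) \<sigma>[of k]
      by (intro monotone_resolvent_pythagoras) auto
    have r: "?r \<le> ?D"
      using pyth zero_le_power2[of "dist (y k) w"] by (intro power2_le_imp_le[of ?r] infdist_nonneg) linarith
    have "?E\<^sup>2 + ?r\<^sup>2 \<le> ?D\<^sup>2"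
      using power_mono[OF infdist_le[OF w(1), of "y k"] infdist_nonneg, of 2] pyth by linarith
    \<comment> \<open>Scaled by the square of \<kappa> so that adding the squared subregularity
      estimate cancels the step length.\<close>
    then have "\<kappa>\<^sup>2 * ?E\<^sup>2 + \<kappa>\<^sup>2 * ?r\<^sup>2 \<le> \<kappa>\<^sup>2 * ?D\<^sup>2"
      by (metis distrib_left mult_left_mono zero_le_power2)
    moreover have "(\<sigma> k)\<^sup>2 * ?E\<^sup>2 \<le> \<kappa>\<^sup>2 * ?r\<^sup>2"
    proof -
      have "\<sigma> k * ?E \<le> \<kappa> * ?r"
        using E \<sigma>[of k] by (simp add: field_simps)
      from power_mono[OF this, of 2] show ?thesis
        using \<sigma>[of k] by (simp add: power_mult_distrib infdist_nonneg)
    qed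
    moreover have pos: "0 < \<kappa>\<^sup>2 + (\<sigma> k)\<^sup>2"
      using \<sigma>[of k] by (intro add_nonneg_pos) auto
    ultimately have "(?E * sqrt (\<kappa>\<^sup>2 + (\<sigma> k)\<^sup>2))\<^sup>2 \<le> (\<kappa> * ?D)\<^sup>2"
      by (simp add: power_mult_distrib algebra_simps)
    then have "?E * sqrt (\<kappa>\<^sup>2 + (\<sigma> k)\<^sup>2) \<le> \<kappa> * ?D"
      by (rule power2_le_imp_le) (simp add: \<kappa> infdist_nonneg)
    then have E': "?E \<le> \<kappa> * (\<kappa>\<^sup>2 + (\<sigma> k)\<^sup>2) powr (- 1 / 2) * ?D"
      using pos by (simp add: powr_minus_divide powr_half_sqrt field_simps)
    let ?d = "dist (x (Suc k)) (x k)"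
    \<comment> \<open>The error is relative to the actual step \<open>?d\<close>, which therefore
      appears on both sides and is solved for.\<close>
    have "?d \<le> \<delta> k * ?d + ?D"
      using err[of k] r dist_triangle[of "x (Suc k)" "x k" "y k"] by (simp add: dist_commute)
    then have d: "?d \<le> ?D / (1 - \<delta> k)"
      using elim by (simp add: field_simps)
    have "infdist (x (Suc k)) ?S \<le> ?E + \<delta> k * ?d"
      using infdist_triangle[of "x (Suc k)" ?S "y k"] err[of k] by linarith
    also have "\<dots> \<le> ?E + \<delta> k * (?D / (1 - \<delta> k))"
      using d \<delta>(1)[of k] by (intro add_left_mono mult_left_mono)
    \<comment> \<open>The first term is weakened so that both share the denominator occurring in
      \<open>rate\<close>.\<close>
    also have "\<dots> \<le> ?E / (1 - \<delta> k) + \<delta> k * (?D / (1 - \<delta> k))"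
    proof -
      have "?E * (1 - \<delta> k) \<le> ?E"
        using \<delta>(1)[of k] by (simp add: algebra_simps infdist_nonneg)
      then have "?E \<le> ?E / (1 - \<delta> k)"
        using elim by (simp add: pos_le_divide_eq)
      then show ?thesis by simp
    qed
    also have "\<dots> = (?E + \<delta> k * ?D) / (1 - \<delta> k)"
      by (simp add: add_divide_distrib)
    also have "\<dots> \<le> (\<kappa> * (\<kappa>\<^sup>2 + (\<sigma> k)\<^sup>2) powr (- 1 / 2) * ?D + \<delta> k * ?D) / (1 - \<delta> k)"
      using E' elim by (intro divide_right_mono) auto
    also have "\<dots> = rate \<kappa> (\<sigma> k) (\<delta> k) * ?D"
      by (simp add: rate_def field_simps)
    finally show ?case .
  qed
qed

lemma rate_tendsto:
  assumes "0 < s" "0 \<le> \<kappa>" "\<sigma> \<longlonglongrightarrow> s" "\<delta> \<longlonglongrightarrow> 0"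
  shows "(\<lambda>k. rate \<kappa> (\<sigma> k) (\<delta> k)) \<longlonglongrightarrow> \<kappa> * (\<kappa>\<^sup>2 + s\<^sup>2) powr (- 1 / 2)"
    and "\<kappa> * (\<kappa>\<^sup>2 + s\<^sup>2) powr (- 1 / 2) < 1"
proof -
  have pos: "0 < \<kappa>\<^sup>2 + s\<^sup>2"
    using assms(1) by (intro add_nonneg_pos) auto
  have "(\<lambda>k. rate \<kappa> (\<sigma> k) (\<delta> k)) \<longlonglongrightarrow> (\<kappa> * (\<kappa>\<^sup>2 + s\<^sup>2) powr (- 1 / 2) + 0) * inverse (1 - 0)"
    unfolding rate_def using pos assms(3,4) by (intro tendsto_intros) auto
  then show "(\<lambda>k. rate \<kappa> (\<sigma> k) (\<delta> k)) \<longlonglongrightarrow> \<kappa> * (\<kappa>\<^sup>2 + s\<^sup>2) powr (- 1 / 2)"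
    by simp
  have "\<kappa> < sqrt (\<kappa>\<^sup>2 + s\<^sup>2)"
    using assms(1) by (intro real_less_rsqrt) simp
  then show "\<kappa> * (\<kappa>\<^sup>2 + s\<^sup>2) powr (- 1 / 2) < 1"
    using pos by (simp add: powr_minus_divide powr_half_sqrt)
qed

section \<open>The dual problem\<close>

locale tv_problem =
  fixes K :: "('m::{finite,linorder}, 'n::{finite,linorder}) img \<Rightarrow> ('m, 'n) img"
    and z :: "('m, 'n) img" and \<mu> \<alpha> :: real
  assumes linear_K: "linear K" and \<mu>_nonneg: "0 \<le> \<mu>" and \<alpha>_pos: "0 < \<alpha>"
    and pos_def_H: "pos_def (Hop K \<mu>)"
begin

abbreviation "H \<equiv> Hop K \<mu>"
abbreviation "Hinv \<equiv> inv (Hop K \<mu>)"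
abbreviation feasible :: "('m, 'n) field set" where "feasible \<equiv> dual_ball \<alpha>"
abbreviation "resid l \<equiv> divg l + adjoint K z"
abbreviation "primal_of l \<equiv> Hinv (resid l)"
abbreviation "gradd \<equiv> dual_grad K z \<mu>"
abbreviation "dual_subdiff \<equiv> subdiff (dual_obj K z \<mu> \<alpha>)"

text \<open>The finite part of the dual objective, kept real-valued so that expansions avoid
  extended real arithmetic.\<close>

definition dual_smooth :: "('m, 'n) field \<Rightarrow> real" where
  "dual_smooth l = 1 / 2 * (primal_of l \<bullet> resid l) - 1 / 2 * (norm z)\<^sup>2"

lemma dual_obj_eq: "dual_obj K z \<mu> \<alpha> l = ereal (dual_smooth l) + ind_fun feasible l"
  by (simp add: dual_obj_def dual_smooth_def dual_ball_def Let_def)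

section \<open>The operator H and its inverse\<close>

lemma linear_H: "linear H"
proof -
  note add = linear_add[OF linear_grad] linear_add[OF adjoint_linear[OF linear_grad]]
    linear_add[OF linear_K] linear_add[OF adjoint_linear[OF linear_K]]
  note scale = linear_cmul[OF linear_grad] linear_cmul[OF adjoint_linear[OF linear_grad]]
    linear_cmul[OF linear_K] linear_cmul[OF adjoint_linear[OF linear_K]]
  show ?thesis
    by (rule linearI) (simp_all add: Hop_def add scale scaleR_add_right)
qed

lemma inner_H: "H u \<bullet> v = \<mu> * (grad u \<bullet> grad v) + K u \<bullet> K v"
  by (simp add: Hop_def inner_add_left adjoint_clauses[OF linear_grad] adjoint_clauses[OF linear_K])

lemma bij_H: "bij H"
proof -
  have "inj H"
    using pos_def_H by (force simp: linear_injective_0[OF linear_H] pos_def_def)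
  then show ?thesis
    using linear_injective_imp_surjective[OF linear_H] by (simp add: bij_def)
qed

lemma H_Hinv [simp]: "H (Hinv v) = v"
  by (rule surj_f_inv_f[OF bij_is_surj[OF bij_H]])

lemma Hinv_H [simp]: "Hinv (H v) = v"
  by (rule inv_f_f[OF bij_is_inj[OF bij_H]])

lemma linear_Hinv: "linear Hinv"
proof (rule linearI)
  show "Hinv (a + b) = Hinv a + Hinv b" for a b
    using Hinv_H[of "Hinv a + Hinv b"] by (simp add: linear_add[OF linear_H] del: Hinv_H)
  show "Hinv (c *\<^sub>R a) = c *\<^sub>R Hinv a" for c a
    using Hinv_H[of "c *\<^sub>R Hinv a"] by (simp add: linear_cmul[OF linear_H] del: Hinv_H)
qed

lemma Hinv_symmetric: "Hinv u \<bullet> v = Hinv v \<bullet> u"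
proof -
  have "H a \<bullet> b = H b \<bullet> a" for a b
    unfolding inner_H by (simp add: inner_commute)
  from this[of "Hinv v" "Hinv u"] show ?thesis
    by (simp add: inner_commute)
qed

lemma pos_def_Hinv: "pos_def Hinv"
  unfolding pos_def_def
proof (intro allI impI)
  fix v :: "('m, 'n) img" assume "v \<noteq> 0"
  then have "Hinv v \<noteq> 0"
    by (metis H_Hinv linear_0[OF linear_H])
  then have "0 < H (Hinv v) \<bullet> Hinv v"
    using pos_def_H unfolding pos_def_def by blast
  then show "0 < Hinv v \<bullet> v"
    by (simp add: inner_commute)
qed

lemma Hinv_nonneg: "0 \<le> Hinv v \<bullet> v"
  using pos_def_Hinv by (cases "v = 0") (auto simp: pos_def_def less_imp_le)

lemma H_nonneg: "0 \<le> H v \<bullet> v"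
  using pos_def_H by (cases "v = 0") (auto simp: pos_def_def less_imp_le)

section \<open>Gradient, expansion and subdifferential of the dual objective\<close>

lemma gradd_eq: "gradd l = - grad (primal_of l)"
  by (simp add: dual_grad_def)

lemma inner_gradd: "gradd l \<bullet> w = primal_of l \<bullet> divg w"
  using inner_divg[of w "primal_of l"] by (simp add: gradd_eq inner_commute)

lemma resid_diff: "resid q = resid l + divg (q - l)"
  by (simp add: linear_diff[OF linear_divg])

lemma primal_of_diff: "primal_of q = primal_of l + Hinv (divg (q - l))"
  unfolding resid_diff[of q l] by (rule linear_add[OF linear_Hinv])

lemma gradd_diff: "(gradd q - gradd l) \<bullet> w = Hinv (divg (q - l)) \<bullet> divg w"
  by (simp add: inner_diff_left inner_gradd primal_of_diff[of q l] inner_add_left)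

text \<open>Exact because the smooth part is quadratic. By \<open>inner_gradd\<close> every term
  sees \<open>q - l\<close> only through its divergence, so the smooth part is constant along
  divergence-free directions.\<close>

lemma dual_smooth_expand:
  "dual_smooth q = dual_smooth l + gradd l \<bullet> (q - l) + 1 / 2 * (Hinv (divg (q - l)) \<bullet> divg (q - l))"
proof -
  define a w where "a = resid l" and "w = divg (q - l)"
  have "resid q = a + w"
    unfolding a_def w_def by (rule resid_diff)
  moreover have "Hinv (a + w) = Hinv a + Hinv w"
    by (rule linear_add[OF linear_Hinv])
  ultimately show ?thesis
    unfolding dual_smooth_def inner_gradd a_def[symmetric] w_def[symmetric]
    by (simp add: inner_add_left inner_add_right Hinv_symmetric[of w a])
qed

lemma dual_smooth_line:
  "dual_smooth (l + t *\<^sub>R d) = dual_smooth l + t * (gradd l \<bullet> d) + t\<^sup>2 * (1 / 2 * (Hinv (divg d) \<bullet> divg d))"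
  unfolding dual_smooth_expand[of "l + t *\<^sub>R d" l]
  by (simp add: linear_cmul[OF linear_divg] linear_cmul[OF linear_Hinv] power2_eq_square)

lemma continuous_gradd: "continuous_on S gradd"
proof -
  have "linear (\<lambda>l. - grad (Hinv (divg l)))"
    using linear_compose_neg[OF linear_compose[OF linear_compose[OF linear_divg linear_Hinv] linear_grad]]
    by (simp add: o_def)
  then have "bounded_linear (\<lambda>l. - grad (Hinv (divg l)))"
    by (simp add: linear_conv_bounded_linear)
  then have "continuous_on S (\<lambda>l. - grad (Hinv (divg l)) - grad (Hinv (adjoint K z)))"
    by (intro continuous_intros linear_continuous_on)
  then show ?thesis
    by (simp add: gradd_eq[abs_def] linear_add[OF linear_Hinv] linear_add[OF linear_grad])
qed

lemma tendsto_gradd: "X \<longlonglongrightarrow> l \<Longrightarrow> (\<lambda>n. gradd (X n)) \<longlonglongrightarrow> gradd l"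
  by (rule continuous_on_tendsto_compose[OF continuous_gradd[of UNIV]]) auto

text \<open>The sum rule for a smooth function plus an indicator. One direction compares values on a
  shrinking segment from \<open>l\<close> to \<open>q\<close>; the other uses that the quadratic
  remainder is nonnegative.\<close>

lemma mem_dual_subdiff:
  "v \<in> dual_subdiff l \<longleftrightarrow> l \<in> feasible \<and> (\<forall>q\<in>feasible. (v - gradd l) \<bullet> (q - l) \<le> 0)"
proof (cases "l \<in> feasible")
  case True
  have "v \<in> dual_subdiff l \<longleftrightarrow> (\<forall>q\<in>feasible. dual_smooth l + v \<bullet> (q - l) \<le> dual_smooth q)"
    using True by (auto simp: subdiff_def dual_obj_eq ind_fun_def)
  also have "\<dots> \<longleftrightarrow> (\<forall>q\<in>feasible. (v - gradd l) \<bullet> (q - l) \<le> 0)"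
  proof (intro iffI ballI)
    fix q :: "('m, 'n) field" assume *: "\<forall>q\<in>feasible. dual_smooth l + v \<bullet> (q - l) \<le> dual_smooth q" and q: "q \<in> feasible"
    show "(v - gradd l) \<bullet> (q - l) \<le> 0"
    proof (rule le_zero_if_le_quadratic)
      fix t :: real assume t: "0 < t" "t \<le> 1"
      let ?q = "l + t *\<^sub>R (q - l)"
      have "?q = (1 - t) *\<^sub>R l + t *\<^sub>R q"
        by (simp add: algebra_simps)
      then have "?q \<in> feasible"
        using convexD[OF convex_dual_ball True q, of "1 - t" t] t by simp
      with * have "dual_smooth l + v \<bullet> (?q - l) \<le> dual_smooth ?q"
        by blast
      moreover have "v \<bullet> (?q - l) = t * (v \<bullet> (q - l))"
        by simp
      moreover have "t * ((v - gradd l) \<bullet> (q - l)) = t * (v \<bullet> (q - l)) - t * (gradd l \<bullet> (q - l))"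
        by (simp only: inner_diff_left right_diff_distrib)
      ultimately show "t * ((v - gradd l) \<bullet> (q - l)) \<le> t\<^sup>2 * (1 / 2 * (Hinv (divg (q - l)) \<bullet> divg (q - l)))"
        unfolding dual_smooth_line by linarith
    qed
  next
    fix q :: "('m, 'n) field" assume "\<forall>q\<in>feasible. (v - gradd l) \<bullet> (q - l) \<le> 0" and "q \<in> feasible"
    then have "(v - gradd l) \<bullet> (q - l) \<le> 0" by blast
    then show "dual_smooth l + v \<bullet> (q - l) \<le> dual_smooth q"
      unfolding dual_smooth_expand[of q l] using Hinv_nonneg[of "divg (q - l)"]
      by (simp add: inner_diff_left)
  qed
  finally show ?thesis using True by simp
qed (simp add: subdiff_def dual_obj_eq ind_fun_def)

lemma zero_mem_dual_ball: "0 \<in> feasible"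
  using \<alpha>_pos by (simp add: mem_dual_ball)

lemma minimizers_dual_obj: "minimizers (dual_obj K z \<mu> \<alpha>) = {l. 0 \<in> dual_subdiff l}"
proof -
  \<comment> \<open>\<open>subdiff\<close> demands a finite value; a minimizer has one because 0 is
    feasible.\<close>
  have fin: "\<bar>dual_obj K z \<mu> \<alpha> l\<bar> \<noteq> \<infinity>" if "\<forall>q. dual_obj K z \<mu> \<alpha> l \<le> dual_obj K z \<mu> \<alpha> q" for l
    using that[rule_format, of 0] zero_mem_dual_ball by (auto simp: dual_obj_eq ind_fun_def split: if_splits)
  have zero_iff: "0 \<in> dual_subdiff l \<longleftrightarrow> \<bar>dual_obj K z \<mu> \<alpha> l\<bar> \<noteq> \<infinity> \<and> (\<forall>q. dual_obj K z \<mu> \<alpha> l \<le> dual_obj K z \<mu> \<alpha> q)" for l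
    unfolding subdiff_def by (simp flip: zero_ereal_def)
  show ?thesis
    unfolding minimizers_def
    by (rule Collect_cong, rule iffI) (use fin zero_iff in \<open>simp_all only: simp_thms\<close>)
qed

lemma dual_subdiff_monotone:
  assumes "v \<in> dual_subdiff x" "w \<in> dual_subdiff y"
  shows "0 \<le> (v - w) \<bullet> (x - y)"
proof -
  have "(v - gradd x) \<bullet> (y - x) \<le> 0" "(w - gradd y) \<bullet> (x - y) \<le> 0"
    using assms by (auto simp: mem_dual_subdiff)
  moreover have "0 \<le> (gradd x - gradd y) \<bullet> (x - y)"
    unfolding gradd_diff by (rule Hinv_nonneg)
  ultimately show ?thesis
    by (simp add: inner_diff_left inner_diff_right)
qed

lemma dual_subdiff_closed:
  assumes "X \<longlonglongrightarrow> x" "V \<longlonglongrightarrow> v" "\<And>n::nat. V n \<in> dual_subdiff (X n)"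
  shows "v \<in> dual_subdiff x"
  unfolding mem_dual_subdiff
proof (intro conjI ballI)
  show "x \<in> feasible"
    using closed_sequentially[OF compact_imp_closed[OF compact_dual_ball]] assms(1,3) mem_dual_subdiff
    by blast
  fix q :: "('m, 'n) field" assume q: "q \<in> feasible"
  have "(\<lambda>n. (V n - gradd (X n)) \<bullet> (q - X n)) \<longlonglongrightarrow> (v - gradd x) \<bullet> (q - x)"
    by (intro tendsto_intros tendsto_gradd assms)
  then show "(v - gradd x) \<bullet> (q - x) \<le> 0"
    by (rule LIMSEQ_le_const2) (use assms(3) q mem_dual_subdiff in blast)
qed

lemma closed_dual_solutions: "closed {l. 0 \<in> dual_subdiff l}"
  unfolding closed_sequential_limits
proof (intro allI impI)
  fix X l assume X: "(\<forall>n. X n \<in> {l. 0 \<in> dual_subdiff l}) \<and> X \<longlonglongrightarrow> l"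
  then show "l \<in> {l. 0 \<in> dual_subdiff l}"
    using dual_subdiff_closed[of X l "\<lambda>_. 0"] by simp
qed

text \<open>The witness minimizes the smooth part plus a multiple of the squared distance to
  \<open>l\<close> over the compact feasible set. Choosing \<open>s = 0\<close> gives a dual
  solution and the reciprocal of a step size gives a proximal point, so one compactness argument
  serves both.\<close>

lemma dual_variational_solution:
  assumes "0 \<le> s"
  obtains b where "b \<in> feasible"
    "\<And>q. q \<in> feasible \<Longrightarrow> 0 \<le> (gradd b + s *\<^sub>R (b - l)) \<bullet> (q - b)"
proof -
  let ?F = "\<lambda>q. dual_smooth q + s / 2 * (norm (q - l))\<^sup>2"
  have "continuous_on feasible ?F"
  proof -
    have "bounded_linear divg" "bounded_linear (\<lambda>q. Hinv (divg q))"
      using linear_divg linear_compose[OF linear_divg linear_Hinv]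
      by (simp_all add: o_def linear_conv_bounded_linear)
    then show ?thesis
      unfolding dual_smooth_def linear_add[OF linear_Hinv]
      by (intro continuous_intros linear_continuous_on)
  qed
  from continuous_attains_inf[OF compact_dual_ball _ this] zero_mem_dual_ball
  obtain b where b: "b \<in> feasible" "\<And>q. q \<in> feasible \<Longrightarrow> ?F b \<le> ?F q"
    by blast
  show thesis
  proof (rule that[OF b(1)])
    fix q :: "('m, 'n) field" assume q: "q \<in> feasible"
    let ?g = "gradd b + s *\<^sub>R (b - l)"
    have "- (?g \<bullet> (q - b)) \<le> 0"
    proof (rule le_zero_if_le_quadratic)
      fix t :: real assume t: "0 < t" "t \<le> 1"
      let ?q = "b + t *\<^sub>R (q - b)"
      have "?q = (1 - t) *\<^sub>R b + t *\<^sub>R q"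
        by (simp add: algebra_simps)
      then have "?q \<in> feasible"
        using convexD[OF convex_dual_ball b(1) q, of "1 - t" t] t by simp
      then have "?F b \<le> ?F ?q" by (rule b(2))
      moreover have "(norm (?q - l))\<^sup>2 = (norm (b - l))\<^sup>2 + 2 * t * ((b - l) \<bullet> (q - b)) + t\<^sup>2 * (norm (q - b))\<^sup>2"
      proof -
        have "?q - l = (b - l) + t *\<^sub>R (q - b)"
          by simp
        then show ?thesis
          by (simp only: power2_norm_add inner_scaleR_right norm_scaleR power_mult_distrib power2_abs mult.assoc)
      qed
      moreover have "dual_smooth ?q = dual_smooth b + t * (gradd b \<bullet> (q - b)) + t\<^sup>2 * (1 / 2 * (Hinv (divg (q - b)) \<bullet> divg (q - b)))"
        by (rule dual_smooth_line)
      moreover have "t * (- (?g \<bullet> (q - b))) = - (t * (gradd b \<bullet> (q - b))) - s * (t * ((b - l) \<bullet> (q - b)))"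
        by (simp only: inner_add_left inner_scaleR_left distrib_left minus_add_distrib mult_minus_right)
          (simp add: mult.left_commute)
      moreover have "s / 2 * (x + 2 * t * y + t\<^sup>2 * z) = s / 2 * x + s * (t * y) + t\<^sup>2 * (s / 2 * z)" for x y z
        by (simp add: algebra_simps)
      ultimately show "t * (- (?g \<bullet> (q - b)))
          \<le> t\<^sup>2 * (1 / 2 * (Hinv (divg (q - b)) \<bullet> divg (q - b)) + s / 2 * (norm (q - b))\<^sup>2)"
        by (simp only: distrib_left)
    qed
    then show "0 \<le> ?g \<bullet> (q - b)" by simp
  qed
qed

lemma dual_solution_exists: obtains l where "0 \<in> dual_subdiff l"
proof -
  obtain b where "b \<in> feasible" "\<And>q. q \<in> feasible \<Longrightarrow> 0 \<le> (gradd b + 0 *\<^sub>R (b - 0)) \<bullet> (q - b)"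
    using dual_variational_solution[of 0 0] by blast
  then have "0 \<in> dual_subdiff b"
    by (simp add: mem_dual_subdiff)
  then show thesis by (rule that)
qed

lemma dual_prox_exists:
  assumes "0 < s"
  obtains b where "(l - b) /\<^sub>R s \<in> dual_subdiff b"
proof -
  obtain b where b: "b \<in> feasible"
    "\<And>q. q \<in> feasible \<Longrightarrow> 0 \<le> (gradd b + inverse s *\<^sub>R (b - l)) \<bullet> (q - b)"
    using dual_variational_solution[of "inverse s" l] assms by (metis inverse_nonnegative_iff_nonnegative less_imp_le)
  have eq: "(l - b) /\<^sub>R s - gradd b = - (gradd b + inverse s *\<^sub>R (b - l))"
    by (simp add: algebra_simps)
  have "(l - b) /\<^sub>R s \<in> dual_subdiff b"
    unfolding mem_dual_subdiff eq inner_minus_left using b by simp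
  then show thesis by (rule that)
qed

section \<open>The augmented Lagrangian\<close>

lemma data_term_expand:
  "data_term K z \<mu> v = data_term K z \<mu> u + (H u - adjoint K z) \<bullet> (v - u) + 1 / 2 * (H (v - u) \<bullet> (v - u))"
proof -
  define w where "w = v - u"
  have v: "v = u + w" by (simp add: w_def)
  have K: "K v - z = (K u - z) + K w" and G: "grad v = grad u + grad w"
    by (simp_all add: v linear_add[OF linear_K] linear_add[OF linear_grad])
  show ?thesis
    unfolding data_term_def K G power2_norm_add w_def[symmetric]
    by (simp add: inner_diff_left inner_H adjoint_clauses[OF linear_K] power2_norm_eq_inner algebra_simps)
qed

text \<open>Fenchel equality: for \<open>p\<close> normal to the feasible set at \<open>l\<close>,
  the two support function bounds meet.\<close>

lemma norm_one_eq_inner: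
  assumes "l \<in> feasible" "\<And>q. q \<in> feasible \<Longrightarrow> p \<bullet> (q - l) \<le> 0"
  shows "\<alpha> * norm_one p = l \<bullet> p"
  using norm_one_le_inner[OF assms(2) \<alpha>_pos] inner_le_norm_one[OF assms(1)] by (intro antisym) auto

text \<open>At this point the gradient of the data term is \<open>divg l\<close>, and
  \<open>l\<close> is a subgradient of the weighted norm at \<open>grad ?u\<close>, because
  optimality of \<open>l\<close> makes \<open>grad ?u\<close> normal to the feasible set. The two
  linear terms cancel by adjointness.\<close>

lemma primal_minimizer:
  assumes "0 \<in> dual_subdiff l"
  shows "primal_of l \<in> minimizers (primal_obj K z \<mu> \<alpha>)"
proof -
  let ?u = "primal_of l"
  have l: "l \<in> feasible" "\<alpha> * norm_one (grad ?u) = l \<bullet> grad ?u"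
    using assms norm_one_eq_inner[of l "grad ?u"] by (auto simp: mem_dual_subdiff gradd_eq)
  have "primal_obj K z \<mu> \<alpha> ?u \<le> primal_obj K z \<mu> \<alpha> v" for v
  proof -
    have "divg l \<bullet> (v - ?u) = - (l \<bullet> grad v) + l \<bullet> grad ?u"
      by (simp add: inner_divg linear_diff[OF linear_grad] inner_diff_right)
    then show ?thesis
      using data_term_expand[of v ?u] H_nonneg[of "v - ?u"] l(2) inner_le_norm_one[OF l(1), of "grad v"]
      by (simp add: primal_obj_def)
  qed
  then show ?thesis by (simp add: minimizers_def)
qed

text \<open>The gradient of the data term at \<open>u\<close> is \<open>divg b\<close>, and
  \<open>b\<close> is a subgradient of the weighted norm at \<open>p\<close>. What remains is a
  quadratic in \<open>r = grad v - q\<close> and \<open>c = grad u - p\<close>; completing the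
  square gives the last term, since
  \<open>l + s *\<^sub>R r - b = s *\<^sub>R (r - c)\<close>.\<close>

lemma aug_lagr_growth:
  fixes s :: real and l b :: "('m, 'n) field"
  assumes "0 < s" "(l - b) /\<^sub>R s \<in> dual_subdiff b"
  defines "u \<equiv> primal_of b"
  defines "p \<equiv> grad u - (b - l) /\<^sub>R s"
  shows "aug_lagr K z \<mu> \<alpha> s l u p + 1 / 2 * (H (v - u) \<bullet> (v - u))
      + (norm (l + s *\<^sub>R (grad v - q) - b))\<^sup>2 / (2 * s) \<le> aug_lagr K z \<mu> \<alpha> s l v q"
proof -
  \<comment> \<open>In this form the proximal inclusion says that \<open>p\<close> is normal to the
    feasible set at \<open>b\<close>.\<close>
  have p_eq: "p = (l - b) /\<^sub>R s - gradd b"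
    by (simp add: p_def u_def gradd_eq algebra_simps)
  have b: "b \<in> feasible" "\<alpha> * norm_one p = b \<bullet> p"
    using assms(2) norm_one_eq_inner[of b p] by (auto simp: mem_dual_subdiff p_eq)
  define r where "r = grad v - q"
  define c where "c = grad u - p"
  have bl: "b = l + s *\<^sub>R c"
    using assms(1) by (simp add: c_def p_def)
  have "data_term K z \<mu> v = data_term K z \<mu> u + divg b \<bullet> (v - u) + 1 / 2 * (H (v - u) \<bullet> (v - u))"
    using data_term_expand[of v u] by (simp add: u_def)
  moreover have "divg b \<bullet> (v - u) = - (b \<bullet> (r - c)) - b \<bullet> (q - p)"
    by (simp add: inner_divg linear_diff[OF linear_grad] r_def c_def inner_diff_right)
  moreover have "\<alpha> * norm_one p + b \<bullet> (q - p) \<le> \<alpha> * norm_one q"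
    using inner_le_norm_one[OF b(1), of q] b(2) by (simp add: inner_diff_right)
  moreover have "- (b \<bullet> (r - c)) + l \<bullet> r + s / 2 * (norm r)\<^sup>2
      = l \<bullet> c + s / 2 * (norm c)\<^sup>2 + (norm (l + s *\<^sub>R r - b))\<^sup>2 / (2 * s)"
  proof -
    have "(norm (l + s *\<^sub>R r - b))\<^sup>2 / (2 * s) = s / 2 * (norm (r - c))\<^sup>2"
      using assms(1) by (simp add: bl scaleR_diff_right[symmetric] power_mult_distrib power2_eq_square)
    then show ?thesis
      by (simp add: bl power2_norm_eq_inner algebra_simps inner_commute)
  qed
  ultimately show ?thesis
    unfolding aug_lagr_def r_def[symmetric] c_def[symmetric] by linarith
qed

lemma alm_gap_lower_bound:
  assumes "0 < s" "(l - b) /\<^sub>R s \<in> dual_subdiff b"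
  shows "1 / 2 * (H (v - primal_of b) \<bullet> (v - primal_of b))
      + (norm (l + s *\<^sub>R (grad v - q) - b))\<^sup>2 / (2 * s) \<le> alm_gap K z \<mu> \<alpha> s l v q"
proof -
  let ?u = "primal_of b" and ?p = "grad (primal_of b) - (b - l) /\<^sub>R s"
  \<comment> \<open>The real infimum lies below each value only when the values are bounded below;
    the exact minimizer \<open>(?u, ?p)\<close> supplies that bound.\<close>
  have "bdd_below ((\<lambda>(v, q). aug_lagr K z \<mu> \<alpha> s l v q) ` UNIV)"
  proof (rule bdd_belowI2)
    fix x :: "('m, 'n) img \<times> ('m, 'n) field"
    show "aug_lagr K z \<mu> \<alpha> s l ?u ?p \<le> (case x of (v, q) \<Rightarrow> aug_lagr K z \<mu> \<alpha> s l v q)"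
    proof -
      obtain v q where x: "x = (v, q)" by (rule prod.exhaust)
      have "0 \<le> (norm (l + s *\<^sub>R (grad v - q) - b))\<^sup>2 / (2 * s)"
        using assms(1) by simp
      then show ?thesis
        using aug_lagr_growth[OF assms, of v q] H_nonneg[of "v - ?u"] x by simp
    qed
  qed
  then have "(INF (v, q)\<in>UNIV. aug_lagr K z \<mu> \<alpha> s l v q) \<le> aug_lagr K z \<mu> \<alpha> s l ?u ?p"
    using cINF_lower[of "\<lambda>(v, q). aug_lagr K z \<mu> \<alpha> s l v q" UNIV "(?u, ?p)"] by simp
  then show ?thesis
    using aug_lagr_growth[OF assms, of v q] by (simp add: alm_gap_def)
qed

section \<open>Metric subregularity\<close>

text \<open>Summed over all pixels this is the Fenchel equality for the negative gradient. By
  Cauchy-Schwarz each pixel contributes a nonnegative term, so every term vanishes.\<close>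

lemma dual_solution_pixel:
  assumes "0 \<in> dual_subdiff l"
  shows "\<alpha> * norm (pixel (gradd l) i j) = - (pixel l i j \<bullet> pixel (gradd l) i j)"
proof -
  let ?g = "gradd l"
  have l: "l \<in> feasible" and "\<alpha> * norm_one (- ?g) = l \<bullet> (- ?g)"
    using assms norm_one_eq_inner[of l "- ?g"] by (auto simp: mem_dual_subdiff)
  then have sum0: "(\<Sum>i\<in>UNIV. \<Sum>j\<in>UNIV. \<alpha> * norm (pixel ?g i j) + pixel l i j \<bullet> pixel ?g i j) = 0"
    by (simp add: norm_one_def inner_field sum.distrib sum_distrib_left sum_negf)
  have nonneg: "0 \<le> \<alpha> * norm (pixel ?g i j) + pixel l i j \<bullet> pixel ?g i j" for i j
  proof -
    have "\<bar>pixel l i j \<bullet> pixel ?g i j\<bar> \<le> norm (pixel l i j) * norm (pixel ?g i j)"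
      by (rule Cauchy_Schwarz_ineq2)
    also have "\<dots> \<le> \<alpha> * norm (pixel ?g i j)"
      using l by (intro mult_right_mono) (auto simp: mem_dual_ball)
    finally show ?thesis by linarith
  qed
  have "(\<Sum>j\<in>UNIV. \<alpha> * norm (pixel ?g i j) + pixel l i j \<bullet> pixel ?g i j) = 0"
    using sum0 nonneg by (subst (asm) sum_nonneg_eq_0_iff) (auto intro: sum_nonneg)
  then have "\<alpha> * norm (pixel ?g i j) + pixel l i j \<bullet> pixel ?g i j = 0"
    using nonneg by (subst (asm) sum_nonneg_eq_0_iff) auto
  then show ?thesis by simp
qed

lemma dual_subdiff_metrically_subregular:
  assumes l: "0 \<in> dual_subdiff l" and sc: "strict_compl K z \<mu> \<alpha> l"
  shows "\<exists>\<kappa>. metrically_subregular dual_subdiff l 0 \<kappa>"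
proof -
  define A where "A i j \<longleftrightarrow> norm (pixel l i j) = \<alpha>" for i j
  \<comment> \<open>Small elements of the kernel of \<open>L\<close> move \<open>l\<close> within
    the solution set, and the norm of \<open>L (x - l)\<close> is what the two growth estimates
    control.\<close>
  define L where "L w = (divg w, restrict_field A w)" for w
  have l_le: "norm (pixel l i j) \<le> \<alpha>" for i j
    using l by (simp add: mem_dual_subdiff mem_dual_ball)
  have inactive: "pixel (gradd l) i j = 0" if "\<not> A i j" for i j
  proof (rule ccontr)
    assume "pixel (gradd l) i j \<noteq> 0"
    moreover have "\<alpha> * norm (pixel (gradd l) i j) \<le> norm (pixel l i j) * norm (pixel (gradd l) i j)"
      using dual_solution_pixel[OF l, of i j] Cauchy_Schwarz_ineq2[of "pixel l i j" "pixel (gradd l) i j"]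
      by linarith
    ultimately have "\<alpha> \<le> norm (pixel l i j)"
      by simp
    with l_le[of i j] that show False
      by (simp add: A_def)
  qed
  have active: "0 < norm (pixel (gradd l) i j) / (2 * \<alpha>)" if "A i j" for i j
    using sc that \<alpha>_pos by (force simp: strict_compl_def Let_def A_def)
  obtain c where c: "0 < c" "\<And>i j. 0 < norm (pixel (gradd l) i j) / (2 * \<alpha>) \<Longrightarrow> c \<le> norm (pixel (gradd l) i j) / (2 * \<alpha>)"
    using finite_positive_lower_bound[of "\<lambda>i j. norm (pixel (gradd l) i j) / (2 * \<alpha>)"] by blast
  obtain \<rho> where \<rho>: "0 < \<rho>" "\<And>i j. 0 < \<alpha> - norm (pixel l i j) \<Longrightarrow> \<rho> \<le> \<alpha> - norm (pixel l i j)"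
    using finite_positive_lower_bound[of "\<lambda>i j. \<alpha> - norm (pixel l i j)"] by blast
  obtain cS where cS: "0 < cS" "\<And>v. cS * (norm v)\<^sup>2 \<le> Hinv v \<bullet> v"
    using pos_def_coercive[OF linear_Hinv pos_def_Hinv] by blast
  have "linear L"
    unfolding L_def[abs_def]
    by (rule linearI)
      (simp_all add: linear_add[OF linear_divg] linear_add[OF linear_restrict] linear_cmul[OF linear_divg] linear_cmul[OF linear_restrict])
  then obtain C where C: "0 < C" "\<And>x. \<exists>w. L w = 0 \<and> norm w \<le> norm x \<and> C * norm (x - w) \<le> norm (L x)"
    using kernel_error_bound by blast
  \<comment> \<open>The growth constant of the weaker of the two estimates, times the error bound
    constant of \<open>L\<close>, squared because the growth is quadratic.\<close>
  define m where "m = min c cS * C\<^sup>2"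
  have m: "0 < m"
    using c(1) cS(1) C(1) by (simp add: m_def)

  \<comment> \<open>By curvature of the disc at active pixels, where the gradient is nonzero.\<close>
  have growth: "c * (norm (restrict_field A (x - l)))\<^sup>2 \<le> gradd l \<bullet> (x - l)" if "x \<in> feasible" for x
  proof -
    have "c * (norm (restrict_field A (x - l)))\<^sup>2
        = (\<Sum>i\<in>UNIV. \<Sum>j\<in>UNIV. if A i j then c * (norm (pixel (x - l) i j))\<^sup>2 else 0)"
      by (simp add: power2_norm_eq_inner inner_field sum_distrib_left if_distrib cong: if_cong)
    also have "\<dots> \<le> (\<Sum>i\<in>UNIV. \<Sum>j\<in>UNIV. pixel (gradd l) i j \<bullet> pixel (x - l) i j)"
    proof (intro sum_mono)
      fix i j
      show "(if A i j then c * (norm (pixel (x - l) i j))\<^sup>2 else 0) \<le> pixel (gradd l) i j \<bullet> pixel (x - l) i j"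
      proof (cases "A i j")
        case True
        have "c * (norm (pixel (x - l) i j))\<^sup>2 \<le> norm (pixel (gradd l) i j) / (2 * \<alpha>) * (norm (pixel (x - l) i j))\<^sup>2"
          using c(2) active[OF True] by (intro mult_right_mono) auto
        also have "\<dots> \<le> pixel (gradd l) i j \<bullet> pixel (x - l) i j"
          using ball_boundary_growth[OF dual_solution_pixel[OF l, of i j], of "pixel x i j"] True that \<alpha>_pos
          by (simp add: A_def mem_dual_ball)
        finally show ?thesis using True by simp
      qed (simp add: inactive)
    qed
    finally show ?thesis
      by (simp add: inner_field)
  qed

  have bound: "infdist x {x. 0 \<in> dual_subdiff x} \<le> norm v / m" if x: "x \<in> ball l \<rho>" "v \<in> dual_subdiff x" for x v
  proof -
    obtain w where w: "L w = 0" "norm w \<le> norm (x - l)" "C * norm (x - l - w) \<le> norm (L (x - l))"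
      using C(2) by blast
    have div_w: "divg w = 0" and restrict_w: "restrict_field A w = 0"
      using w(1) by (simp_all add: L_def zero_prod_def)
    \<comment> \<open>This point is a dual solution: the inactive pixels have slack at least \<open>\<rho>\<close>.\<close>
    let ?x = "l + w"
    have "norm (pixel ?x i j) \<le> \<alpha>" for i j
    proof (cases "A i j")
      case True
      then have "pixel w i j = 0"
        using arg_cong[OF restrict_w, of "\<lambda>q. pixel q i j"] by simp
      then show ?thesis
        using l_le by simp
    next
      case False
      then have "\<rho> \<le> \<alpha> - norm (pixel l i j)"
        using l_le[of i j] by (intro \<rho>(2)) (simp add: A_def)
      moreover have "norm (pixel w i j) < \<rho>"
        using norm_pixel_le[of w i j] w(2) x(1) by (simp add: dist_norm norm_minus_commute)
      ultimately show ?thesis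
        using norm_triangle_ineq[of "pixel l i j" "pixel w i j"] by simp
    qed
    then have xf: "?x \<in> feasible"
      by (simp add: mem_dual_ball)
    have g_eq: "gradd ?x = gradd l"
      by (simp add: gradd_eq linear_add[OF linear_divg] div_w)
    have g_w: "gradd l \<bullet> w = 0"
      by (simp add: inner_gradd div_w)
    have "0 \<in> dual_subdiff ?x"
      using l g_w xf by (auto simp: mem_dual_subdiff g_eq inner_diff_right inner_add_right)
    then have dist: "infdist x {x. 0 \<in> dual_subdiff x} \<le> norm (x - ?x)"
      by (metis infdist_le mem_Collect_eq dist_norm)
    let ?e = "x - ?x"
    have e: "?e = x - l - w" by simp
    have div_e: "divg ?e = divg (x - l)"
      unfolding e linear_diff[OF linear_divg, of _ w] div_w by simp
    \<comment> \<open>The subgradient inequality at \<open>x\<close> is tested with the nearby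
      solution. Splitting \<open>gradd x\<close> into \<open>gradd ?x\<close> and its increment
      yields the growth in the active pixels and the growth in the divergence.\<close>
    have xfeas: "x \<in> feasible" and "(v - gradd x) \<bullet> (?x - x) \<le> 0"
      using x(2) xf by (auto simp: mem_dual_subdiff)
    then have "gradd x \<bullet> ?e \<le> v \<bullet> ?e"
      by (simp add: inner_diff_left inner_diff_right)
    moreover have "(gradd x - gradd ?x) \<bullet> ?e = Hinv (divg (x - l)) \<bullet> divg (x - l)"
      unfolding gradd_diff div_e ..
    moreover have "gradd ?x \<bullet> ?e = gradd l \<bullet> (x - l)"
      by (simp add: g_eq e inner_diff_right g_w)
    ultimately have "cS * (norm (divg (x - l)))\<^sup>2 + c * (norm (restrict_field A (x - l)))\<^sup>2 \<le> v \<bullet> ?e"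
      using cS(2)[of "divg (x - l)"] growth[OF xfeas] by (simp only: inner_diff_left)
    also have "v \<bullet> ?e \<le> norm v * norm ?e"
      by (rule norm_cauchy_schwarz)
    finally have "cS * (norm (divg (x - l)))\<^sup>2 + c * (norm (restrict_field A (x - l)))\<^sup>2 \<le> norm v * norm ?e" .
    moreover have "min c cS * (norm (L (x - l)))\<^sup>2
        \<le> cS * (norm (divg (x - l)))\<^sup>2 + c * (norm (restrict_field A (x - l)))\<^sup>2"
      by (simp add: L_def norm_Pair distrib_left add_mono mult_right_mono)
    moreover have "m * (norm ?e)\<^sup>2 \<le> min c cS * (norm (L (x - l)))\<^sup>2"
    proof -
      have "(C * norm ?e)\<^sup>2 \<le> (norm (L (x - l)))\<^sup>2"
        using w(3) C(1) by (intro power_mono) (simp_all add: e)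
      then show ?thesis
        using c(1) cS(1) by (simp add: m_def mult.assoc power_mult_distrib mult_left_mono)
    qed
    ultimately have "m * (norm ?e)\<^sup>2 \<le> norm v * norm ?e"
      by linarith
    then have "norm ?e * (m * norm ?e) \<le> norm ?e * norm v"
      by (simp add: power2_eq_square mult_ac)
    then have "m * norm ?e \<le> norm v"
      by (cases "norm ?e = 0") auto
    then have "norm ?e \<le> norm v / m"
      using m by (simp add: field_simps)
    with dist show ?thesis by linarith
  qed
  have "metrically_subregular dual_subdiff l 0 (1 / m)"
    unfolding metrically_subregular_def
  proof (intro conjI, goal_cases)
    case 3
    show ?case
    \<comment> \<open>The estimate \<open>bound\<close> covers subgradients of every size, so the
      whole space serves as \<open>V\<close>; the infimum over \<open>v\<close> gives the modulus
      \<open>1 / m\<close>.\<close>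
    proof (rule exI[of _ "ball l \<rho>"], rule exI[of _ UNIV], intro conjI ballI impI)
      fix x assume x: "x \<in> ball l \<rho>" "dual_subdiff x \<inter> UNIV \<noteq> {}"
      have "m * infdist x {x. 0 \<in> dual_subdiff x} \<le> infdist 0 (dual_subdiff x)"
        unfolding infdist_notempty[OF x(2)[unfolded Int_UNIV_right]]
        using x(2) bound[OF x(1)] m by (intro cINF_greatest) (auto simp: field_simps)
      then show "infdist x {x. 0 \<in> dual_subdiff x} \<le> 1 / m * infdist 0 (dual_subdiff x \<inter> UNIV)"
        using m by (simp add: field_simps)
    qed (use \<rho>(1) in auto)
  qed (use l m in auto)
  then show ?thesis ..
qed

end

section \<open>Convergence and rate of the augmented Lagrangian method\<close>

theorem theorem5:
  fixes K :: "('m::{finite,linorder}, 'n::{finite,linorder}) img \<Rightarrow> ('m, 'n) img"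
    and z :: "('m, 'n) img"
    and \<mu> \<alpha> \<sigma>_inf :: real
    and \<sigma> \<epsilon> :: "nat \<Rightarrow> real"
    and u :: "nat \<Rightarrow> ('m, 'n) img"
    and p lam :: "nat \<Rightarrow> ('m, 'n) field"
  assumes "linear K" and "0 \<le> \<mu>" and "0 < \<alpha>"
    and "pos_def (Hop K \<mu>)"
    and "\<And>k. 0 < \<sigma> k" and "incseq \<sigma>" and "\<sigma> \<longlonglongrightarrow> \<sigma>_inf"
    and p_step: "\<And>k. p (Suc k) = soft_thresh (\<alpha> / \<sigma> k) (lam k /\<^sub>R \<sigma> k + grad (u (Suc k)))"
    and lam_step: "\<And>k. lam (Suc k) = lam k + \<sigma> k *\<^sub>R (grad (u (Suc k)) - p (Suc k))"
    and "\<And>k. 0 \<le> \<epsilon> k" and "summable \<epsilon>"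
    and crit_A: "\<And>k. alm_gap K z \<mu> \<alpha> (\<sigma> k) (lam k) (u (Suc k)) (p (Suc k))
                    \<le> (\<epsilon> k)\<^sup>2 / (2 * \<sigma> k)"
  shows "bounded (range (\<lambda>k. (u k, p k, lam k))) \<and>
    (\<exists>us ps ls.
      (\<lambda>k. (u k, p k, lam k)) \<longlonglongrightarrow> (us, ps, ls) \<and>
      us \<in> minimizers (primal_obj K z \<mu> \<alpha>) \<and>
      ps = grad us \<and>
      ls \<in> minimizers (dual_obj K z \<mu> \<alpha>) \<and>
      (strict_compl K z \<mu> \<alpha> ls \<longrightarrow>
        (\<exists>\<kappa>. metrically_subregular (subdiff (dual_obj K z \<mu> \<alpha>)) ls 0 \<kappa>) \<and>
        (\<forall>\<kappa>d \<delta>.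
          metrically_subregular (subdiff (dual_obj K z \<mu> \<alpha>)) ls 0 \<kappa>d \<and>
          (\<forall>k. 0 \<le> \<delta> k) \<and> summable \<delta> \<and>
          (\<forall>k. alm_gap K z \<mu> \<alpha> (\<sigma> k) (lam k) (u (Suc k)) (p (Suc k))
                \<le> (\<delta> k)\<^sup>2 / (2 * \<sigma> k) * (norm (lam (Suc k) - lam k))\<^sup>2)
          \<longrightarrow>
          lam \<longlonglongrightarrow> ls \<and>
          (\<forall>\<^sub>F k in sequentially.
            infdist (lam (Suc k)) (minimizers (dual_obj K z \<mu> \<alpha>))
              \<le> rate \<kappa>d (\<sigma> k) (\<delta> k) * infdist (lam k) (minimizers (dual_obj K z \<mu> \<alpha>))) \<and>
          (\<lambda>k. rate \<kappa>d (\<sigma> k) (\<delta> k)) \<longlonglongrightarrow> \<kappa>d * (\<kappa>d\<^sup>2 + \<sigma>_inf\<^sup>2) powr (- 1 / 2) \<and>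
          \<kappa>d * (\<kappa>d\<^sup>2 + \<sigma>_inf\<^sup>2) powr (- 1 / 2) < 1)))"
proof -
  interpret tv_problem K z \<mu> \<alpha>
    by (rule tv_problem.intro) (fact assms)+
  note \<sigma>_pos = \<open>\<And>k. 0 < \<sigma> k\<close> and \<epsilon>_nonneg = \<open>\<And>k. 0 \<le> \<epsilon> k\<close>
  have \<sigma>_ge: "\<sigma> 0 \<le> \<sigma> k" for k
    using \<open>incseq \<sigma>\<close> by (simp add: incseq_def)
  have \<sigma>_inf: "0 < \<sigma>_inf"
    using LIMSEQ_le_const[OF \<open>\<sigma> \<longlonglongrightarrow> \<sigma>_inf\<close>, of "\<sigma> 0"] \<sigma>_ge \<sigma>_pos[of 0] by fastforce
  \<comment> \<open>The exact proximal points of the computed multipliers, with which the inexact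
    iterates are compared.\<close>
  obtain y where y: "\<And>k. (lam k - y k) /\<^sub>R \<sigma> k \<in> dual_subdiff (y k)"
  proof -
    have "\<forall>k. \<exists>b. (lam k - b) /\<^sub>R \<sigma> k \<in> dual_subdiff b"
      using dual_prox_exists[OF \<sigma>_pos] by blast
    from choice[OF this] show thesis
      using that by blast
  qed
  define v where "v k = u (Suc k) - primal_of (y k)" for k
  have gap: "1 / 2 * (H (v k) \<bullet> v k) + (dist (lam (Suc k)) (y k))\<^sup>2 / (2 * \<sigma> k)
      \<le> alm_gap K z \<mu> \<alpha> (\<sigma> k) (lam k) (u (Suc k)) (p (Suc k))" for k
    using alm_gap_lower_bound[OF \<sigma>_pos[of k] y, of "u (Suc k)" "p (Suc k)"]
    by (simp add: v_def dist_norm lam_step)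
  \<comment> \<open>Stated for general \<open>a\<close>: criterion (A) uses
    \<open>a = \<epsilon> k\<close>, criterion (B1) uses \<delta> k times the length of the
    multiplier step.\<close>
  have dist_le: "dist (lam (Suc k)) (y k) \<le> a"
    if "alm_gap K z \<mu> \<alpha> (\<sigma> k) (lam k) (u (Suc k)) (p (Suc k)) \<le> a\<^sup>2 / (2 * \<sigma> k)" "0 \<le> a" for k a
  proof -
    have "(dist (lam (Suc k)) (y k))\<^sup>2 / (2 * \<sigma> k) \<le> a\<^sup>2 / (2 * \<sigma> k)"
      using gap[of k] that(1) H_nonneg[of "v k"] by simp
    then have "(dist (lam (Suc k)) (y k))\<^sup>2 \<le> a\<^sup>2"
      using \<sigma>_pos[of k] by (simp add: divide_le_cancel)
    then show ?thesis
      using that(2) by (rule power2_le_imp_le)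
  qed
  obtain ls where ls: "0 \<in> dual_subdiff ls" "lam \<longlonglongrightarrow> ls" "y \<longlonglongrightarrow> ls"
  proof -
    obtain l0 where l0: "0 \<in> dual_subdiff l0"
      by (rule dual_solution_exists)
    show thesis
      by (rule inexact_proximal_point_converges[where T = dual_subdiff and s = "\<sigma> 0"
            and \<sigma> = \<sigma> and x = lam and y = y and e = \<epsilon>])
        (fact dual_subdiff_monotone dual_subdiff_closed l0 \<sigma>_pos \<sigma>_ge y
          dist_le[OF crit_A \<epsilon>_nonneg] \<open>summable \<epsilon>\<close> that)+
  qed
  have v: "v \<longlonglongrightarrow> 0"
  proof -
    obtain c where c: "0 < c" "\<And>w. c * (norm w)\<^sup>2 \<le> H w \<bullet> w"
      using pos_def_coercive[OF linear_H pos_def_H] by blast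
    have "(norm (v k))\<^sup>2 \<le> (\<epsilon> k)\<^sup>2 / (c * \<sigma> 0)" for k
    proof -
      have "0 \<le> (dist (lam (Suc k)) (y k))\<^sup>2 / (2 * \<sigma> k)"
        using \<sigma>_pos[of k] by simp
      then have "c * (norm (v k))\<^sup>2 \<le> 2 * ((\<epsilon> k)\<^sup>2 / (2 * \<sigma> k))"
        using gap[of k] crit_A[of k] c(2)[of "v k"] by linarith
      also have "\<dots> \<le> (\<epsilon> k)\<^sup>2 / \<sigma> 0"
        using \<sigma>_pos[of 0] \<sigma>_ge[of k] by (simp add: frac_le)
      finally show ?thesis
        using c(1) \<sigma>_pos[of 0] by (simp add: field_simps)
    qed
    moreover have "(\<lambda>k. (\<epsilon> k)\<^sup>2 / (c * \<sigma> 0)) \<longlonglongrightarrow> 0\<^sup>2 / (c * \<sigma> 0)"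
      using c(1) \<sigma>_pos[of 0]
      by (intro tendsto_intros summable_LIMSEQ_zero[OF \<open>summable \<epsilon>\<close>]) simp
    then have "(\<lambda>k. (\<epsilon> k)\<^sup>2 / (c * \<sigma> 0)) \<longlonglongrightarrow> 0"
      by simp
    ultimately have "(\<lambda>k. norm (v k)) \<longlonglongrightarrow> 0"
      by (rule tendsto_zero_if_square_le)
    then show ?thesis
      by (simp only: tendsto_norm_zero_iff)
  qed
  define us where "us = primal_of ls"
  have grad_tendsto: "(\<lambda>k. grad (X k)) \<longlonglongrightarrow> grad x" if "X \<longlonglongrightarrow> x" for X x
    using bounded_linear.tendsto[OF _ that] linear_grad by (simp add: linear_conv_bounded_linear)
  have "(\<lambda>k. primal_of (y k)) \<longlonglongrightarrow> us"
  proof -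
    have "bounded_linear (\<lambda>l. Hinv (divg l))"
      using linear_compose[OF linear_divg linear_Hinv] by (simp add: o_def linear_conv_bounded_linear)
    from bounded_linear.tendsto[OF this ls(3)]
    show ?thesis
      unfolding us_def linear_add[OF linear_Hinv] by (intro tendsto_intros)
  qed
  from tendsto_add[OF v this] have "(\<lambda>k. u (Suc k)) \<longlonglongrightarrow> us"
    by (simp add: v_def)
  \<comment> \<open>The multiplier update is solved for \<open>p (Suc k)\<close>: its distance to
    \<open>grad (u (Suc k))\<close> is the multiplier step divided by \<sigma> k, which vanishes
    because \<sigma> is bounded away from 0.\<close>
  moreover have "(\<lambda>k. p (Suc k)) \<longlonglongrightarrow> grad us"
  proof -
    have "(\<lambda>k. lam (Suc k) - lam k) \<longlonglongrightarrow> 0"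
      using tendsto_diff[OF LIMSEQ_Suc[OF ls(2)] ls(2)] by simp
    from tendsto_scaleR_inverse_zero[OF this \<sigma>_pos[of 0] \<sigma>_ge]
    have "(\<lambda>k. grad (u (Suc k)) - (lam (Suc k) - lam k) /\<^sub>R \<sigma> k) \<longlonglongrightarrow> grad us - 0"
      by (intro tendsto_diff grad_tendsto \<open>(\<lambda>k. u (Suc k)) \<longlonglongrightarrow> us\<close>)
    moreover have "grad (u (Suc k)) - (lam (Suc k) - lam k) /\<^sub>R \<sigma> k = p (Suc k)" for k
      using \<sigma>_pos[of k] by (simp add: lam_step)
    ultimately show ?thesis by simp
  qed
  \<comment> \<open>The initial \<open>u 0\<close> and \<open>p 0\<close> are arbitrary, so these
    limits were shown for the shifted sequences.\<close>
  ultimately have lim: "(\<lambda>k. (u k, p k, lam k)) \<longlonglongrightarrow> (us, grad us, ls)"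
    using ls(2) by (intro tendsto_Pair) (simp_all add: LIMSEQ_imp_Suc)
  have rate: "lam \<longlonglongrightarrow> ls \<and>
      (\<forall>\<^sub>F k in sequentially.
        infdist (lam (Suc k)) (minimizers (dual_obj K z \<mu> \<alpha>))
          \<le> rate \<kappa>d (\<sigma> k) (\<delta> k) * infdist (lam k) (minimizers (dual_obj K z \<mu> \<alpha>))) \<and>
      (\<lambda>k. rate \<kappa>d (\<sigma> k) (\<delta> k)) \<longlonglongrightarrow> \<kappa>d * (\<kappa>d\<^sup>2 + \<sigma>_inf\<^sup>2) powr (- 1 / 2) \<and>
      \<kappa>d * (\<kappa>d\<^sup>2 + \<sigma>_inf\<^sup>2) powr (- 1 / 2) < 1"
    if sub: "metrically_subregular dual_subdiff ls 0 \<kappa>d" and \<delta>: "\<And>k. 0 \<le> \<delta> k" "summable \<delta>"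
      and crit_B: "\<And>k. alm_gap K z \<mu> \<alpha> (\<sigma> k) (lam k) (u (Suc k)) (p (Suc k))
                \<le> (\<delta> k)\<^sup>2 / (2 * \<sigma> k) * (norm (lam (Suc k) - lam k))\<^sup>2" for \<kappa>d \<delta>
  proof -
    have \<delta>0: "\<delta> \<longlonglongrightarrow> 0"
      by (rule summable_LIMSEQ_zero[OF \<delta>(2)])
    have \<kappa>: "0 \<le> \<kappa>d"
      using sub by (simp add: metrically_subregular_def)
    have err: "dist (lam (Suc k)) (y k) \<le> \<delta> k * dist (lam (Suc k)) (lam k)" for k
      using crit_B[of k] \<delta>(1)[of k] by (intro dist_le) (simp_all add: power_mult_distrib dist_norm)
    have "\<forall>\<^sub>F k in sequentially. infdist (lam (Suc k)) {l. 0 \<in> dual_subdiff l}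
        \<le> rate \<kappa>d (\<sigma> k) (\<delta> k) * infdist (lam k) {l. 0 \<in> dual_subdiff l}"
      by (rule inexact_proximal_point_rate[where T = dual_subdiff and x' = ls and s = "\<sigma> 0" and y = y])
        (fact dual_subdiff_monotone closed_dual_solutions \<sigma>_pos \<sigma>_ge y ls sub err \<delta> \<delta>0)+
    then show ?thesis
      unfolding minimizers_dual_obj
      using rate_tendsto[OF \<sigma>_inf \<kappa> \<open>\<sigma> \<longlonglongrightarrow> \<sigma>_inf\<close> \<delta>0] ls(2) by blast
  qed
  have "us \<in> minimizers (primal_obj K z \<mu> \<alpha>)" "ls \<in> minimizers (dual_obj K z \<mu> \<alpha>)"
    using primal_minimizer[OF ls(1)] ls(1) by (simp_all add: us_def minimizers_dual_obj)
  moreover have "strict_compl K z \<mu> \<alpha> ls \<Longrightarrow> \<exists>\<kappa>. metrically_subregular dual_subdiff ls 0 \<kappa>"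
    using dual_subdiff_metrically_subregular[OF ls(1)] .
  moreover have "bounded (range (\<lambda>k. (u k, p k, lam k)))"
    using lim by (intro convergent_imp_bounded) 
  ultimately show ?thesis
    using lim rate by blast
qed

end
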